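(* Let $n$ be a positive integer and $0\le k\le n-1$. Let $B^S_{n,k}=\{\sigma\in S_n:\mathrm{del}_S(\sigma)=k\}$ and $B^A_{n+1,k}=\{\sigma\in A_{n+1}:\mathrm{del}_A(\sigma)=k\}$. Then (1) $\sum_{\sigma\in B^S_{n,k}}q^{\ell_S(\sigma)}=\sum_{\sigma\in B^S_{n,k}}q^{\mathrm{rmaj}_{S_n}(\sigma)}$, and (2) $\sum_{\sigma\in B^A_{n+1,k}}q^{\ell_A(\sigma)}=\sum_{\sigma\in B^A_{n+1,k}}q^{\mathrm{rmaj}_{A_{n+1}}(\sigma)}$.
   Context: Permutations are in one-line notation and multiplied as functions, $(\sigma\tau)(k)=\sigma(\tau(k))$; $s_i=(i,i+1)$. $\mathrm{Des}_S(\pi)=\{i\in[n-1]:\pi(i)>\pi(i+1)\}$, $\mathrm{rmaj}_{S_n}(\pi)=\sum_{i\in\mathrm{Des}_S(\pi)}(n-i)$, $\ell_S(\pi)$ = number of inversions. $R^S_j=\{1,s_j,s_js_{j-1},\dots,s_j\cdots s_1\}$ ($1\le j\le n-1$); every $w\in S_n$ factors uniquely as $w_1\cdots w_{n-1}$, $w_j\in R^S_j$, and $\mathrm{del}_S(w)$ is the number of $j$ with $w_j=s_j\cdots s_1$. In $S_{n+1}$, $a_i=s_1s_{i+1}$ ($1\le i\le n-1$); $R^A_j=\{1,a_j,a_ja_{j-1},\dots,a_j\cdots a_2,a_j\cdots a_2a_1,a_j\cdots a_2a_1^{-1}\}$ (words; $R^A_1=\{1,a_1,a_1^{-1}\}$).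 Every $v\in A_{n+1}$ factors uniquely as $v_1\cdots v_{n-1}$, $v_j\in R^A_j$; $\ell_A(v)$ = total number of letters, $\mathrm{del}_A(v)$ = number of letters $a_1^{\pm1}$. $\mathrm{Des}_A(\sigma)=\{1\le i\le n-1:\ell_A(\sigma)\ge\ell_A(\sigma a_i)\}$, $\mathrm{rmaj}_{A_{n+1}}(\sigma)=\sum_{i\in\mathrm{Des}_A(\sigma)}(n-i)$. *)

theory Defs
  imports "HOL-Combinatorics.Combinatorics" "HOL-Computational_Algebra.Polynomial"
    "HOL-Library.FuncSet"
begin

text \<open>Permutations of \<open>{1..n}\<close> are functions \<open>nat \<Rightarrow> nat\<close> fixing everything outside \<open>{1..n}\<close>;
  the product is composition, so in a product the rightmost factor acts first.\<close>

definition perm_prod :: "(nat \<Rightarrow> nat) list \<Rightarrow> nat \<Rightarrow> nat" where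
  "perm_prod ps = foldr (\<circ>) ps id"

definition Sym :: "nat \<Rightarrow> (nat \<Rightarrow> nat) set" where
  "Sym n = {\<sigma>. \<sigma> permutes {1..n}}"

definition Alt :: "nat \<Rightarrow> (nat \<Rightarrow> nat) set" where
  "Alt n = {\<sigma>. \<sigma> permutes {1..n} \<and> evenperm \<sigma>}"

definition s_gen :: "nat \<Rightarrow> nat \<Rightarrow> nat" where
  "s_gen i = transpose i (i + 1)"


definition Des_S :: "nat \<Rightarrow> (nat \<Rightarrow> nat) \<Rightarrow> nat set" where
  "Des_S n \<pi> = {i \<in> {1..n - 1}. \<pi> i > \<pi> (i + 1)}"

definition rmaj_S :: "nat \<Rightarrow> (nat \<Rightarrow> nat) \<Rightarrow> nat" where
  "rmaj_S n \<pi> = (\<Sum>i\<in>Des_S n \<pi>. n - i)"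

definition len_S :: "nat \<Rightarrow> (nat \<Rightarrow> nat) \<Rightarrow> nat" where
  "len_S n \<pi> = card {(i, j). 1 \<le> i \<and> i < j \<and> j \<le> n \<and> \<pi> i > \<pi> j}"

text \<open>\<open>s_down j m\<close> is \<open>s\<^sub>j s\<^sub>j\<^sub>-\<^sub>1 \<cdots> s\<^sub>m\<close>, which is the identity for \<open>m = j + 1\<close>.\<close>

definition s_down :: "nat \<Rightarrow> nat \<Rightarrow> nat \<Rightarrow> nat" where
  "s_down j m = perm_prod (map s_gen (rev [m..<j + 1]))"

definition R_S :: "nat \<Rightarrow> (nat \<Rightarrow> nat) set" where
  "R_S j = s_down j ` {1..j + 1}"

text \<open>The canonical factorization \<open>w = w\<^sub>1 \<cdots> w\<^sub>n\<^sub>-\<^sub>1\<close> of \<open>w \<in> Sym n\<close> with \<open>w\<^sub>j \<in> R_S j\<close>, as the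
  function \<open>j \<mapsto> w\<^sub>j\<close>; extensionality outside \<open>{1..n - 1}\<close> makes that function unique.\<close>

definition fact_S :: "nat \<Rightarrow> (nat \<Rightarrow> nat) \<Rightarrow> nat \<Rightarrow> (nat \<Rightarrow> nat)" where
  "fact_S n w = (THE f. f \<in> PiE {1..n - 1} R_S \<and> w = perm_prod (map f [1..<n]))"

definition del_S :: "nat \<Rightarrow> (nat \<Rightarrow> nat) \<Rightarrow> nat" where
  "del_S n w = card {j \<in> {1..n - 1}. fact_S n w j = s_down j 1}"


definition a_gen :: "nat \<Rightarrow> nat \<Rightarrow> nat" where
  "a_gen i = s_gen 1 \<circ> s_gen (i + 1)"

datatype letter = Gen nat | Gen_inv nat

fun letter_perm :: "letter \<Rightarrow> nat \<Rightarrow> nat" where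
  "letter_perm (Gen i) = a_gen i"
| "letter_perm (Gen_inv i) = inv (a_gen i)"

definition word_perm :: "letter list \<Rightarrow> nat \<Rightarrow> nat" where
  "word_perm u = perm_prod (map letter_perm u)"

text \<open>\<open>a_down j m\<close> is the word \<open>a\<^sub>j a\<^sub>j\<^sub>-\<^sub>1 \<cdots> a\<^sub>m\<close>, which is empty for \<open>m = j + 1\<close>.\<close>

definition a_down :: "nat \<Rightarrow> nat \<Rightarrow> letter list" where
  "a_down j m = map Gen (rev [m..<j + 1])"

definition R_A :: "nat \<Rightarrow> letter list set" where
  "R_A j = a_down j ` {2..j + 1} \<union> {a_down j 2 @ [Gen 1], a_down j 2 @ [Gen_inv 1]}"

text \<open>The statistics below with first argument \<open>n\<close> concern the group \<open>Alt (n + 1)\<close>, whose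
  generators are \<open>a\<^sub>1, \<dots>, a\<^sub>n\<^sub>-\<^sub>1\<close>.\<close>

definition fact_A :: "nat \<Rightarrow> (nat \<Rightarrow> nat) \<Rightarrow> nat \<Rightarrow> letter list" where
  "fact_A n v = (THE f. f \<in> PiE {1..n - 1} R_A \<and>
     v = perm_prod (map (\<lambda>j. word_perm (f j)) [1..<n]))"

definition len_A :: "nat \<Rightarrow> (nat \<Rightarrow> nat) \<Rightarrow> nat" where
  "len_A n v = (\<Sum>j = 1..n - 1. length (fact_A n v j))"

definition del_A :: "nat \<Rightarrow> (nat \<Rightarrow> nat) \<Rightarrow> nat" where
  "del_A n v = (\<Sum>j = 1..n - 1. length (filter (\<lambda>x. x \<in> {Gen 1, Gen_inv 1}) (fact_A n v j)))"

definition Des_A :: "nat \<Rightarrow> (nat \<Rightarrow> nat) \<Rightarrow> nat set" where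
  "Des_A n \<sigma> = {i \<in> {1..n - 1}. len_A n \<sigma> \<ge> len_A n (\<sigma> \<circ> a_gen i)}"

definition rmaj_A :: "nat \<Rightarrow> (nat \<Rightarrow> nat) \<Rightarrow> nat" where
  "rmaj_A n \<sigma> = (\<Sum>i\<in>Des_A n \<sigma>. n - i)"


definition B_S :: "nat \<Rightarrow> nat \<Rightarrow> (nat \<Rightarrow> nat) set" where
  "B_S n k = {\<sigma> \<in> Sym n. del_S n \<sigma> = k}"

text \<open>\<open>B_A n k\<close> is the subset of \<open>Alt (n + 1)\<close> usually written with index \<open>n + 1\<close>.\<close>

definition B_A :: "nat \<Rightarrow> nat \<Rightarrow> (nat \<Rightarrow> nat) set" where
  "B_A n k = {\<sigma> \<in> Alt (n + 1). del_A n \<sigma> = k}"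

end

theory Submission
  imports Defs
begin

text \<open>
  Multiplying a permutation of \<open>{1..n}\<close> by an element of \<open>R_S n\<close> on the right inserts the new maximum
  \<open>n + 1\<close> into its one-line notation, and \<open>del_S\<close> grows exactly when the insertion is at the front. There
  the inversion number and \<open>rmaj_S\<close> both grow by \<open>n\<close>; over the remaining \<open>n\<close> positions the growth of
  each of them takes every value \<open>0, \<dots>, n - 1\<close> once. So both bivariate generating functions are the
  product of the same factors.

  For the alternating group, a word of \<open>R_A n\<close> is, up to a power of \<open>s\<^sub>1\<close> on the left, the insertion of
  \<open>n + 2\<close> at one of \<open>n + 2\<close> positions, the first two of which play the role of the front. The length
  \<open>len_A\<close> has a closed form, invariant under swapping the first two entries, from which \<open>Des_A\<close> can be read
  off; descent sets then transform under insertion exactly as in the symmetric group, and the factors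
  agree except that the front term is doubled.
\<close>

section \<open>Products of lists of permutations\<close>

lemma perm_prod_Nil [simp]: "perm_prod [] = id"
  by (simp add: perm_prod_def)

lemma perm_prod_Cons [simp]: "perm_prod (p # ps) = p \<circ> perm_prod ps"
  by (simp add: perm_prod_def)

lemma perm_prod_append [simp]: "perm_prod (ps @ qs) = perm_prod ps \<circ> perm_prod qs"
  by (induction ps) (auto simp: comp_assoc)

section \<open>Factorizations along a chain of transversals\<close>

lemma perm_prod_fun_upd:
  assumes "n \<ge> 1"
  shows "perm_prod (map (\<lambda>j. \<phi> ((f(n := r)) j)) [1..<Suc n]) =
    perm_prod (map (\<lambda>j. \<phi> (f j)) [1..<n]) \<circ> \<phi> r"
proof -
  have "map (\<lambda>j. \<phi> ((f(n := r)) j)) [1..<n] = map (\<lambda>j. \<phi> (f j)) [1..<n]"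
    by (rule map_cong) auto
  moreover have "[1..<Suc n] = [1..<n] @ [n]" using assms by simp
  ultimately show ?thesis
    by (simp only: map_append perm_prod_append list.map perm_prod_Cons perm_prod_Nil comp_id fun_upd_same)
qed

lemma bij_betw_prod_swap:
  assumes "bij_betw g B C"
  shows "bij_betw (\<lambda>(r, f). (g f, r)) (A \<times> B) (C \<times> A)"
proof (rule bij_betw_imageI)
  show "inj_on (\<lambda>(r, f). (g f, r)) (A \<times> B)"
    using bij_betw_imp_inj_on[OF assms] by (auto simp: inj_on_def)
  show "(\<lambda>(r, f). (g f, r)) ` (A \<times> B) = C \<times> A"
    unfolding bij_betw_imp_surj_on[OF assms, symmetric] by force
qed

text \<open>Splitting off the last coordinate of a function in the product of the \<open>R j\<close>
  corresponds, under \<open>step\<close>, to splitting off the last factor of a group element, so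
  the bijection propagates by induction. At \<open>n = 1\<close> both sides have one element: the
  empty choice and \<open>id\<close>.\<close>

lemma bij_betw_factorization:
  fixes \<phi> :: "'a \<Rightarrow> nat \<Rightarrow> nat"
  assumes base: "G 1 = {id}"
    and step: "\<And>n. n \<ge> 1 \<Longrightarrow> bij_betw (\<lambda>(u, r). u \<circ> \<phi> r) (G n \<times> R n) (G (Suc n))"
    and "n \<ge> 1"
  shows "bij_betw (\<lambda>f. perm_prod (map (\<lambda>j. \<phi> (f j)) [1..<n])) (PiE {1..n - 1} R) (G n)"
  using \<open>n \<ge> 1\<close>
proof (induction n rule: dec_induct)
  case base
  show ?case using assms(1) by (simp add: bij_betw_def id_def)
next
  case (step n)
  let ?P = "\<lambda>n f. perm_prod (map (\<lambda>j. \<phi> (f j)) [1..<n])"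
  let ?upd = "\<lambda>(r, f). f(n := r)"
  have ins: "{1..Suc n - 1} = insert n {1..n - 1}" and notin: "n \<notin> {1..n - 1}"
    using step by auto
  have upd: "bij_betw ?upd (R n \<times> PiE {1..n - 1} R) (PiE {1..Suc n - 1} R)"
    unfolding bij_betw_def ins by (rule conjI[OF inj_combinator[OF notin] PiE_insert_eq[symmetric]])
  have "bij_betw (\<lambda>(r, f). (?P n f, r)) (R n \<times> PiE {1..n - 1} R) (G n \<times> R n)"
    using step.IH by (rule bij_betw_prod_swap)
  then have "bij_betw ((\<lambda>(u, r). u \<circ> \<phi> r) \<circ> (\<lambda>(r, f). (?P n f, r)))
      (R n \<times> PiE {1..n - 1} R) (G (Suc n))"
    using assms(2)[OF step(1)] by (rule bij_betw_trans)
  moreover have eq: "((\<lambda>(u, r). u \<circ> \<phi> r) \<circ> (\<lambda>(r, f). (?P n f, r))) x = (?P (Suc n) \<circ> ?upd) x" for x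
    using perm_prod_fun_upd[OF step(1), of \<phi>] by (cases x) (simp only: o_apply prod.case)
  ultimately have "bij_betw (?P (Suc n) \<circ> ?upd) (R n \<times> PiE {1..n - 1} R) (G (Suc n))"
    by (simp only: bij_betw_cong[OF eq])
  then show ?case
    by (rule iffD2[OF bij_betw_comp_iff[OF upd]])
qed

text \<open>The recursion for canonical factors. Uniqueness, and with it the value of the definite
  description, comes from the injectivity in \<open>bij_betw_factorization\<close>. \<open>F\<close>
  stays abstract so that one argument covers \<open>fact_S\<close> and
  \<open>fact_A\<close>.\<close>

lemma factorization_step:
  fixes \<phi> :: "'a \<Rightarrow> nat \<Rightarrow> nat"
  assumes base: "G 1 = {id}"
    and step: "\<And>n. n \<ge> 1 \<Longrightarrow> bij_betw (\<lambda>(u, r). u \<circ> \<phi> r) (G n \<times> R n) (G (Suc n))"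
    and F: "\<And>n v. F n v =
      (THE f. f \<in> PiE {1..n - 1} R \<and> v = perm_prod (map (\<lambda>j. \<phi> (f j)) [1..<n]))"
    and "n \<ge> 1" "u \<in> G n" "r \<in> R n"
  shows "F (Suc n) (u \<circ> \<phi> r) = (F n u)(n := r)"
proof -
  let ?P = "\<lambda>n f. perm_prod (map (\<lambda>j. \<phi> (f j)) [1..<n])"
  note bij = bij_betw_factorization[of G \<phi> R, OF base step]
  have unique: "F m (?P m f) = f" if "m \<ge> 1" "f \<in> PiE {1..m - 1} R" for m f
    unfolding F
    using that bij_betw_imp_inj_on[OF bij[OF _ that(1)]] by (intro the_equality) (auto dest: inj_onD)
  obtain f where f: "f \<in> PiE {1..n - 1} R" "u = ?P n f"
    using bij_betw_imp_surj_on[OF bij[OF _ \<open>n \<ge> 1\<close>]] \<open>u \<in> G n\<close> by blast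
  have "u \<circ> \<phi> r = ?P (Suc n) (f(n := r))"
    using f perm_prod_fun_upd[OF \<open>n \<ge> 1\<close>, of \<phi> f r] by simp
  moreover have "f(n := r) \<in> PiE {1..Suc n - 1} R"
  proof -
    have "{1..Suc n - 1} = insert n {1..n - 1}" using \<open>n \<ge> 1\<close> by auto
    then show ?thesis using f \<open>r \<in> R n\<close> by (metis PiE_fun_upd)
  qed
  ultimately have "F (Suc n) (u \<circ> \<phi> r) = f(n := r)"
    using unique[of "Suc n" "f(n := r)"] by simp
  then show ?thesis using unique[OF \<open>n \<ge> 1\<close> f(1)] f(2) by simp
qed

text \<open>The smaller group is the stabilizer of \<open>Suc N\<close>, and two elements lie in the
  same right coset of it exactly when they take the value \<open>Suc N\<close> at the same position.
  Since \<open>pos\<close> is a bijection, \<open>R\<close> supplies one representative for each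
  position. \<open>P\<close> is instantiated by \<open>True\<close> for the symmetric and by
  \<open>evenperm\<close> for the alternating group.\<close>

lemma bij_betw_coset_representatives:
  fixes \<phi> :: "'a \<Rightarrow> nat \<Rightarrow> nat"
  assumes perm: "\<And>r. r \<in> R \<Longrightarrow> \<phi> r permutes {1..Suc N} \<and> P (\<phi> r) \<and> \<phi> r (pos r) = Suc N"
    and pos: "bij_betw pos R {1..Suc N}"
    and comp: "\<And>p q. \<lbrakk>p permutes {1..Suc N}; q permutes {1..Suc N}; P p; P q\<rbrakk> \<Longrightarrow> P (p \<circ> q)"
    and inv: "\<And>p. \<lbrakk>p permutes {1..Suc N}; P p\<rbrakk> \<Longrightarrow> P (inv p)"
  shows "bij_betw (\<lambda>(u, r). u \<circ> \<phi> r) ({u. u permutes {1..N} \<and> P u} \<times> R)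
    {u. u permutes {1..Suc N} \<and> P u}"
proof -
  have up: "u permutes {1..Suc N}" if "u permutes {1..N}" for u
    using that by (rule permutes_subset) auto
  show ?thesis
  proof (rule bij_betw_imageI)
    show "inj_on (\<lambda>(u, r). u \<circ> \<phi> r) ({u. u permutes {1..N} \<and> P u} \<times> R)"
    proof (rule inj_onI, clarsimp)
      fix u r u' r'
      assume u: "u permutes {Suc 0..N}" "u' permutes {Suc 0..N}" and r: "r \<in> R" "r' \<in> R"
        and eq: "u \<circ> \<phi> r = u' \<circ> \<phi> r'"
      have fix_top: "u (Suc N) = Suc N" "u' (Suc N) = Suc N"
        using u by (auto simp: permutes_def)
      have "u' (\<phi> r' (pos r)) = u' (Suc N)"
        using fun_cong[OF eq, of "pos r"] perm[OF r(1)] fix_top by simp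
      then have "\<phi> r' (pos r) = \<phi> r' (pos r')"
        using permutes_inj[OF u(2)] perm[OF r(2)] by (simp add: inj_eq)
      then have "pos r = pos r'"
        using perm[OF r(2)] permutes_inj by (metis injD)
      then have rr: "r = r'"
        using pos r by (auto simp: bij_betw_def dest: inj_onD)
      have "u = u'"
      proof
        fix x
        obtain y where "x = \<phi> r y"
          using perm[OF r(1)] permutes_surj by (metis surjD)
        then show "u x = u' x" using fun_cong[OF eq, of y] rr by simp
      qed
      with rr show "u = u' \<and> r = r'" by simp
    qed
    show "(\<lambda>(u, r). u \<circ> \<phi> r) ` ({u. u permutes {1..N} \<and> P u} \<times> R) =
      {u. u permutes {1..Suc N} \<and> P u}"
    proof (intro equalityI subsetI)
      fix v assume "v \<in> (\<lambda>(u, r). u \<circ> \<phi> r) ` ({u. u permutes {1..N} \<and> P u} \<times> R)"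
      then show "v \<in> {u. u permutes {1..Suc N} \<and> P u}"
        using perm up comp by (auto intro!: permutes_compose)
    next
      fix v assume "v \<in> {u. u permutes {1..Suc N} \<and> P u}"
      then have v: "v permutes {1..Suc N}" "P v" by auto
      have "inv v (Suc N) \<in> {1..Suc N}"
        using permutes_in_image[OF permutes_inv[OF v(1)], of "Suc N"] by auto
      then obtain r where r: "r \<in> R" "pos r = inv v (Suc N)"
        using pos by (metis bij_betw_imp_surj_on imageE)
      have \<phi>: "\<phi> r permutes {1..Suc N}" "P (\<phi> r)" using perm[OF r(1)] by auto
      define u where "u = v \<circ> inv (\<phi> r)"
      have u: "u permutes {1..Suc N}" "P u"
        unfolding u_def using v \<phi> comp[OF v(1) permutes_inv] inv permutes_inv
        by (auto intro!: permutes_compose)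
      have "inv (\<phi> r) (Suc N) = pos r"
        using perm[OF r(1)] permutes_inverses(2)[OF \<phi>(1), of "pos r"] by simp
      then have "u (Suc N) = Suc N"
        unfolding u_def using r permutes_inverses(1)[OF v(1)] by simp
      then have "u permutes {1..N}"
        using u(1) permutes_superset[OF u(1), of "{1..N}"] by (auto simp: le_Suc_eq)
      moreover have "v = u \<circ> \<phi> r"
        unfolding u_def using permutes_inverses(2)[OF \<phi>(1)] by (auto simp: fun_eq_iff)
      ultimately show "v \<in> (\<lambda>(u, r). u \<circ> \<phi> r) ` ({u. u permutes {1..N} \<and> P u} \<times> R)"
        using u r by (intro image_eqI[of _ _ "(u, r)"]) auto
    qed
  qed
qed

section \<open>The permutations \<open>s_down\<close> as insertions of a new maximum\<close>

lemma s_down_Suc: "m \<le> Suc j \<Longrightarrow> s_down (Suc j) m = s_gen (Suc j) \<circ> s_down j m"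
  by (simp add: s_down_def)

lemma s_down_empty [simp]: "s_down j (Suc j) = id"
  by (simp add: s_down_def)

lemma s_down_unfold_right: "m \<le> j \<Longrightarrow> s_down j m = s_down j (Suc m) \<circ> s_gen m"
  by (simp add: s_down_def upt_conv_Cons del: upt_Suc)

text \<open>The cycle behind the insertions: if \<open>u\<close> fixes \<open>Suc j\<close>, then
  \<open>u \<circ> s_down j m\<close> has the entry \<open>Suc j\<close> at position
  \<open>m\<close>, and the entries of \<open>u\<close> from position \<open>m\<close> to
  \<open>j\<close> move one place to the right.\<close>

lemma s_down_apply:
  assumes "m \<le> Suc j"
  shows "s_down j m k = (if k = m then Suc j else if m < k \<and> k \<le> Suc j then k - 1 else k)"
  using assms
proof (induction j)
  case 0
  then show ?case
    by (cases "m = 1") (auto simp: s_down_def s_gen_def transpose_def)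
next
  case (Suc j)
  show ?case
  proof (cases "m = Suc (Suc j)")
    case True
    then show ?thesis by auto
  next
    case False
    then show ?thesis using Suc by (auto simp: s_down_Suc s_gen_def transpose_def)
  qed
qed

lemma s_gen_permutes: "1 \<le> i \<Longrightarrow> i < n \<Longrightarrow> s_gen i permutes {1..n}"
  unfolding s_gen_def by (rule permutes_swap_id) auto

lemma s_gen_s_gen [simp]: "s_gen i \<circ> s_gen i = id"
  by (simp add: s_gen_def)

lemma s_down_permutes:
  assumes "1 \<le> m" "m \<le> Suc j"
  shows "s_down j m permutes {1..Suc j}"
  using assms(2)
proof (induction j)
  case 0
  then have "m = Suc 0" using assms(1) by simp
  then have "s_down 0 m = id" by (simp only: s_down_empty)
  then show ?case by (simp only: permutes_id)
next
  case (Suc j)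
  show ?case
  proof (cases "m = Suc (Suc j)")
    case False
    then have "s_down j m permutes {1..Suc (Suc j)}"
      using Suc by (auto intro: permutes_subset)
    then have "s_gen (Suc j) \<circ> s_down j m permutes {1..Suc (Suc j)}"
      by (rule permutes_compose) (rule s_gen_permutes; simp)
    then show ?thesis
      using False Suc.prems by (simp only: s_down_Suc)
  qed (simp only: s_down_empty permutes_id)
qed

section \<open>The canonical factorization in the symmetric group\<close>

lemma inj_on_s_down: "inj_on (s_down j) {1..Suc j}"
proof (rule inj_onI)
  fix m m' assume "m \<in> {1..Suc j}" "m' \<in> {1..Suc j}" "s_down j m = s_down j m'"
  then show "m = m'"
    using s_down_apply[of m j m] s_down_apply[of m' j m] by (auto split: if_splits)
qed

text \<open>The position attached to \<open>s_down n m\<close> is \<open>m\<close>, where it takes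
  the value \<open>Suc n\<close>; these positions exhaust \<open>{1..Suc n}\<close>.\<close>

lemma bij_betw_Sym_Suc:
  "bij_betw (\<lambda>(u, r). u \<circ> r) (Sym n \<times> R_S n) (Sym (Suc n))"
proof -
  have "bij_betw (the_inv_into {1..Suc n} (s_down n)) (R_S n) {1..Suc n}"
    unfolding R_S_def using inj_on_s_down by (simp add: bij_betw_the_inv_into inj_on_imp_bij_betw)
  moreover have "r permutes {1..Suc n} \<and> True \<and> r (the_inv_into {1..Suc n} (s_down n) r) = Suc n"
    if "r \<in> R_S n" for r
    using that inj_on_s_down[of n] s_down_permutes
    by (auto simp: R_S_def the_inv_into_f_f s_down_apply)
  ultimately show ?thesis
    using bij_betw_coset_representatives[of "R_S n" "\<lambda>r. r" n "\<lambda>_. True"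
        "the_inv_into {1..Suc n} (s_down n)"] by (simp add: Sym_def)
qed

lemma Sym_1: "Sym 1 = {id}"
  by (simp add: Sym_def)

lemma fact_S_Suc:
  assumes "n \<ge> 1" "u \<in> Sym n" "r \<in> R_S n"
  shows "fact_S (Suc n) (u \<circ> r) = (fact_S n u)(n := r)"
  using factorization_step[of Sym "\<lambda>r. r" R_S fact_S, OF Sym_1 bij_betw_Sym_Suc _ assms]
  by (simp add: fact_S_def)

lemma del_S_Suc:
  assumes "n \<ge> 1" "u \<in> Sym n" "m \<in> {1..Suc n}"
  shows "del_S (Suc n) (u \<circ> s_down n m) = del_S n u + (if m = 1 then 1 else 0)"
proof -
  have f: "fact_S (Suc n) (u \<circ> s_down n m) = (fact_S n u)(n := s_down n m)"
    using assms by (intro fact_S_Suc) (auto simp: R_S_def)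
  have "s_down n m = s_down n 1 \<longleftrightarrow> m = 1"
    using inj_on_s_down[of n] assms by (auto dest: inj_onD)
  then have "{j \<in> {1..Suc n - 1}. ((fact_S n u)(n := s_down n m)) j = s_down j 1} =
    {j \<in> {1..n - 1}. fact_S n u j = s_down j 1} \<union> (if m = 1 then {n} else {})"
    using assms by (auto split: if_splits)
  moreover have "card ({j \<in> {1..n - 1}. fact_S n u j = s_down j 1} \<union> (if m = 1 then {n} else {})) =
      card {j \<in> {1..n - 1}. fact_S n u j = s_down j 1} + (if m = 1 then 1 else 0)"
    using assms by (subst card_Un_disjoint) auto
  ultimately show ?thesis unfolding del_S_def f by simp
qed


section \<open>Inversions and insertion of a maximum\<close>

text \<open>Inversions are grouped by their right end because the closed form for
  \<open>len_A\<close> caps exactly these counts.\<close>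

definition inv_at :: "(nat \<Rightarrow> nat) \<Rightarrow> nat \<Rightarrow> nat" where
  "inv_at \<pi> j = card {i \<in> {1..<j}. \<pi> i > \<pi> j}"

lemma len_S_eq_sum: "len_S n \<pi> = (\<Sum>j = 1..n. inv_at \<pi> j)"
proof -
  have "{(i, j). 1 \<le> i \<and> i < j \<and> j \<le> n \<and> \<pi> i > \<pi> j} =
    prod.swap ` (SIGMA j:{1..n}. {i \<in> {1..<j}. \<pi> i > \<pi> j})"
    by (auto simp: image_iff)
  then have "len_S n \<pi> = card (SIGMA j:{1..n}. {i \<in> {1..<j}. \<pi> i > \<pi> j})"
    unfolding len_S_def by (simp add: card_image)
  then show ?thesis by (simp add: inv_at_def)
qed

lemma Sym_le: "u \<in> Sym n \<Longrightarrow> k \<le> n \<Longrightarrow> u k \<le> n"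
  using permutes_in_image[of u "{1..n}" k] permutes_not_in[of u "{1..n}" k]
  by (cases "k \<in> {1..n}") (auto simp: Sym_def)

lemma insert_max_apply:
  assumes "u \<in> Sym n" "m \<in> {1..Suc n}"
  shows "(u \<circ> s_down n m) m = Suc n"
    and "k < m \<Longrightarrow> (u \<circ> s_down n m) k = u k"
    and "m \<le> k \<Longrightarrow> k \<le> n \<Longrightarrow> (u \<circ> s_down n m) (Suc k) = u k"
  using assms permutes_not_in[of u "{1..n}" "Suc n"] by (auto simp: s_down_apply Sym_def)

text \<open>The new maximum forms an inversion with every entry that it pushes to the right and with
  no entry to its left.\<close>

lemma inv_at_insert_max:
  assumes u: "u \<in> Sym n" and m: "m \<in> {1..Suc n}"
  defines "v \<equiv> u \<circ> s_down n m"
  shows "j < m \<Longrightarrow> inv_at v j = inv_at u j"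
    and "inv_at v m = 0"
    and "m \<le> j \<Longrightarrow> j \<le> n \<Longrightarrow> inv_at v (Suc j) = Suc (inv_at u j)"
proof -
  note v = insert_max_apply[OF u m, folded v_def]
  show "inv_at v j = inv_at u j" if "j < m"
    unfolding inv_at_def using that v(2) by (intro arg_cong[where f = card]) auto
  have "v i \<le> Suc n" if "i < m" for i
    using v(2)[OF that] Sym_le[OF u, of i] that m by simp
  then show "inv_at v m = 0"
    unfolding inv_at_def using v(1) by (force simp: not_less)
  show "inv_at v (Suc j) = Suc (inv_at u j)" if "m \<le> j" "j \<le> n"
  proof -
    \<comment> \<open>\<open>?g\<close> sends a position before the insertion to the position of the
      same entry afterwards.\<close>
    let ?g = "\<lambda>i. if i < m then i else Suc i"
    have "{i \<in> {1..<Suc j}. v i > v (Suc j)} = insert m (?g ` {i \<in> {1..<j}. u i > u j})"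
    proof (intro equalityI subsetI)
      fix x assume x: "x \<in> {i \<in> {1..<Suc j}. v i > v (Suc j)}"
      show "x \<in> insert m (?g ` {i \<in> {1..<j}. u i > u j})"
      proof (cases "x > m")
        case True
        then obtain y where "x = Suc y" by (cases x) auto
        then show ?thesis using x True v(3)[OF that] v(3)[of y] that m
          by (intro insertI2 image_eqI[of _ _ y]) auto
      next
        case False
        then show ?thesis using x v(2)[of x] v(3)[OF that] that by auto
      qed
    next
      fix x assume "x \<in> insert m (?g ` {i \<in> {1..<j}. u i > u j})"
      then show "x \<in> {i \<in> {1..<Suc j}. v i > v (Suc j)}"
        using v that m Sym_le[OF u, of j] by (auto simp: less_Suc_eq_le)
    qed
    moreover have "m \<notin> ?g ` {i \<in> {1..<j}. u i > u j}" by auto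
    moreover have "inj_on ?g {i \<in> {1..<j}. u i > u j}" by (auto simp: inj_on_def)
    ultimately show ?thesis unfolding inv_at_def by (simp only: card_image card_insert_disjoint finite_imageI finite_Collect_conjI finite_atLeastLessThan Collect_mem_eq simp_thms)
  qed
qed

text \<open>Here \<open>g\<close> and \<open>f\<close> are the contributions of the entries before
  and after an insertion at \<open>p\<close>, and \<open>e\<close> is the gain of each shifted
  entry. For \<open>len_S\<close> the gain is constantly 1; for \<open>alt_len\<close> it vanishes
  at the first position.\<close>

lemma sum_insertion:
  fixes f g e :: "nat \<Rightarrow> nat"
  assumes "p \<in> {1..Suc N}" and "\<And>j. 1 \<le> j \<Longrightarrow> j < p \<Longrightarrow> f j = g j" and "f p = 0"
    and "\<And>j. p \<le> j \<Longrightarrow> j \<le> N \<Longrightarrow> f (Suc j) = g j + e j"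
  shows "(\<Sum>j = 1..Suc N. f j) = (\<Sum>j = 1..N. g j) + (\<Sum>j = p..N. e j)"
proof -
  have "{1..Suc N} = {1..<p} \<union> insert p {Suc p..Suc N}" using assms(1) by auto
  then have "(\<Sum>j = 1..Suc N. f j) = (\<Sum>j = 1..<p. f j) + (\<Sum>j = Suc p..Suc N. f j)"
    using assms(3) by (subst \<open>{1..Suc N} = _\<close>, subst sum.union_disjoint) auto
  also have "(\<Sum>j = Suc p..Suc N. f j) = (\<Sum>j = p..N. g j + e j)"
    unfolding sum.shift_bounds_cl_Suc_ivl using assms(4) by (intro sum.cong) auto
  also have "(\<Sum>j = 1..<p. f j) = (\<Sum>j = 1..<p. g j)"
    using assms(2) by (intro sum.cong) auto
  moreover have "{1..N} = {1..<p} \<union> {p..N}" using assms(1) by auto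
  then have "(\<Sum>j = 1..N. g j) = (\<Sum>j = 1..<p. g j) + (\<Sum>j = p..N. g j)"
    by (simp only:) (subst sum.union_disjoint; auto)
  ultimately show ?thesis by (simp add: sum.distrib)
qed

lemma len_S_Suc:
  assumes "u \<in> Sym n" "m \<in> {1..Suc n}"
  shows "len_S (Suc n) (u \<circ> s_down n m) = len_S n u + (Suc n - m)"
  unfolding len_S_eq_sum
  using sum_insertion[OF assms(2), of "inv_at (u \<circ> s_down n m)" "inv_at u" "\<lambda>_. 1"]
    inv_at_insert_max[OF assms] by simp

section \<open>Descent sets and insertion of a maximum\<close>

text \<open>\<open>insert_des n m D\<close> is the descent set after a new maximum is inserted at position \<open>m\<close> into a
  permutation of \<open>{1..n}\<close> with descent set \<open>D\<close>: the ascent or descent at \<open>m - 1\<close> is replaced by an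
  ascent followed by a descent. \<open>insert_inc n D m\<close> is the resulting growth of \<open>rmaj\<close>.\<close>

definition insert_des :: "nat \<Rightarrow> nat \<Rightarrow> nat set \<Rightarrow> nat set" where
  "insert_des n m D = {i \<in> D. Suc i < m} \<union> (if m \<le> n then {m} else {}) \<union> Suc ` {i \<in> D. m \<le> i}"

definition insert_inc :: "nat \<Rightarrow> nat set \<Rightarrow> nat \<Rightarrow> nat" where
  "insert_inc n D m = card {i \<in> D. Suc i < m} + (if m - 1 \<in> D then 0 else Suc n - m)"

lemma Des_S_Suc:
  assumes u: "u \<in> Sym n" and m: "m \<in> {1..Suc n}"
  shows "Des_S (Suc n) (u \<circ> s_down n m) = insert_des n m (Des_S n u)"
proof (rule set_eqI)
  fix i
  obtain v where v_def: "v = u \<circ> s_down n m" by simp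
  note v = insert_max_apply[OF u m, folded v_def]
  consider "Suc i < m" | "Suc i = m" | "i = m" | "m < i" by linarith
  then have "i \<in> Des_S (Suc n) v \<longleftrightarrow> i \<in> insert_des n m (Des_S n u)"
  proof cases
    case 1
    then show ?thesis using v(2)[of i] v(2)[of "Suc i"] m by (auto simp: Des_S_def insert_des_def)
  next
    case 2
    then show ?thesis using v(1) v(2)[of i] m Sym_le[OF u, of i]
      by (auto simp: Des_S_def insert_des_def)
  next
    case 3
    then show ?thesis using v(1) v(3)[of i] m Sym_le[OF u, of i]
      by (auto simp: Des_S_def insert_des_def)
  next
    case 4
    then obtain k where "i = Suc k" by (cases i) auto
    then show ?thesis using 4 v(3)[of k] v(3)[of i] m by (auto simp: Des_S_def insert_des_def)
  qed
  then show "i \<in> Des_S (Suc n) (u \<circ> s_down n m) \<longleftrightarrow> i \<in> insert_des n m (Des_S n u)"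
    by (simp only: v_def)
qed

text \<open>Passing from \<open>n\<close> to \<open>Suc n\<close> raises the weight of each descent
  left of the insertion by one, while the shift by one position cancels this on the right. The new
  descent \<open>m\<close> weighs \<open>Suc n - m\<close>, which is also the old weight of a
  destroyed descent \<open>m - 1\<close>, so the two cancel when \<open>m - 1\<close> lies in
  \<open>D\<close>.\<close>

lemma sum_insert_des:
  assumes D: "D \<subseteq> {1..<n}" and m: "m \<in> {1..Suc n}"
  shows "(\<Sum>i\<in>insert_des n m D. Suc n - i) = (\<Sum>i\<in>D. n - i) + insert_inc n D m"
proof -
  have fin [simp]: "finite D" using D finite_subset by blast
  let ?A = "{i \<in> D. Suc i < m}" and ?B = "{i \<in> D. m \<le> i}"
  have split: "sum f (A \<union> B \<union> C) = sum f A + sum f B + sum f C"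
    if "finite A" "finite B" "finite C" "A \<inter> B = {}" "A \<inter> C = {}" "B \<inter> C = {}"
    for A B C :: "nat set" and f :: "nat \<Rightarrow> nat"
    using that by (simp add: sum.union_disjoint Int_Un_distrib2)
  have "(\<Sum>i\<in>insert_des n m D. Suc n - i) =
      (\<Sum>i\<in>?A. Suc n - i) + (\<Sum>i\<in>(if m \<le> n then {m} else {}). Suc n - i) + (\<Sum>i\<in>Suc ` ?B. Suc n - i)"
    unfolding insert_des_def by (rule split) auto
  also have "(\<Sum>i\<in>?A. Suc n - i) = (\<Sum>i\<in>?A. (n - i) + 1)"
    using D by (intro sum.cong) (auto simp: subset_iff Suc_diff_le)
  also have "\<dots> = (\<Sum>i\<in>?A. n - i) + card ?A"
    by (simp only: sum.distrib card_eq_sum)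
  also have "(\<Sum>i\<in>(if m \<le> n then {m} else {}). Suc n - i) = Suc n - m"
    using m by auto
  also have "(\<Sum>i\<in>Suc ` ?B. Suc n - i) = (\<Sum>i\<in>?B. n - i)"
    by (simp add: sum.reindex)
  finally have 1: "(\<Sum>i\<in>insert_des n m D. Suc n - i) =
    (\<Sum>i\<in>?A. n - i) + card ?A + (Suc n - m) + (\<Sum>i\<in>?B. n - i)" .
  have "D = ?A \<union> (D \<inter> {m - 1}) \<union> ?B" using m D by auto
  then have "(\<Sum>i\<in>D. n - i) = (\<Sum>i\<in>?A \<union> (D \<inter> {m - 1}) \<union> ?B. n - i)" by (rule arg_cong)
  also have "\<dots> = (\<Sum>i\<in>?A. n - i) + (\<Sum>i\<in>D \<inter> {m - 1}. n - i) + (\<Sum>i\<in>?B. n - i)"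
    using D m by (intro split) auto
  also have "(\<Sum>i\<in>D \<inter> {m - 1}. n - i) = (if m - 1 \<in> D then Suc n - m else 0)"
    using m by auto
  finally show ?thesis using 1 by (auto simp: insert_inc_def)
qed

text \<open>There is no descent at 0 that an insertion at the front could destroy.\<close>

lemma insert_inc_1: "D \<subseteq> {1..<n} \<Longrightarrow> insert_inc n D 1 = n"
  by (auto simp: insert_inc_def)

text \<open>Positions directly after a descent receive the small values 0, 1, ... from left to
  right; the other positions receive the remaining values from right to left. As there are
  \<open>n\<close> positions, distinctness and the bound by \<open>n\<close> are enough.\<close>

lemma bij_betw_insert_inc:
  assumes D: "D \<subseteq> {1..<n}"
  shows "bij_betw (insert_inc n D) {2..Suc n} {..<n}"
proof -
  have fin: "finite D" using D finite_subset by blast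
  define c where "c m = card {i \<in> D. Suc i < m}" for m
  have inc: "insert_inc n D m = c m + (if m - 1 \<in> D then 0 else Suc n - m)" for m
    by (simp add: insert_inc_def c_def)
  have c_le: "c m \<le> m - 2" if "m \<ge> 2" for m
  proof -
    have "{i \<in> D. Suc i < m} \<subseteq> {1..<m - 1}" using D by auto
    from card_mono[OF _ this] show ?thesis by (simp add: c_def)
  qed
  \<comment> \<open>From \<open>m\<close> to \<open>m'\<close> the count \<open>c\<close> gains the
    descent at \<open>m - 1\<close>, if there is one, and the descents among
    \<open>m, ..., m' - 2\<close>.\<close>
  have c_diff: "c m + (if m - 1 \<in> D then 1 else 0) \<le> c m'"
    "c m' \<le> c m + (if m - 1 \<in> D then 1 else 0) + (m' - m - 1)"
    if "2 \<le> m" "m < m'" for m m'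
  proof -
    have "{i \<in> D. Suc i < m'} =
      {i \<in> D. Suc i < m} \<union> (D \<inter> {m - 1}) \<union> {i \<in> D. m \<le> i \<and> Suc i < m'}"
      using that by auto
    then have "c m' = card ({i \<in> D. Suc i < m} \<union> (D \<inter> {m - 1}) \<union> {i \<in> D. m \<le> i \<and> Suc i < m'})"
      unfolding c_def by simp
    also have "\<dots> = c m + card (D \<inter> {m - 1}) + card {i \<in> D. m \<le> i \<and> Suc i < m'}"
      unfolding c_def using fin that by (subst card_Un_disjoint, auto)+
    finally have *: "c m' = c m + (if m - 1 \<in> D then 1 else 0) + card {i \<in> D. m \<le> i \<and> Suc i < m'}"
      by auto
    have "{i \<in> D. m \<le> i \<and> Suc i < m'} \<subseteq> {m..<m' - 1}" by auto
    from card_mono[OF _ this] have "card {i \<in> D. m \<le> i \<and> Suc i < m'} \<le> m' - m - 1" by simp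
    with * show "c m + (if m - 1 \<in> D then 1 else 0) \<le> c m'"
      "c m' \<le> c m + (if m - 1 \<in> D then 1 else 0) + (m' - m - 1)" by auto
  qed
  \<comment> \<open>If \<open>m - 1\<close> lies in \<open>D\<close>, the value at \<open>m\<close>
    is \<open>c m\<close>, which is smaller than \<open>c m'\<close> and so smaller than the value
    at \<open>m'\<close>. Otherwise the upper bound on \<open>c m'\<close> makes the value at
    \<open>m\<close> the larger one.\<close>
  have neq: "insert_inc n D m \<noteq> insert_inc n D m'" if "2 \<le> m" "m < m'" "m' \<le> Suc n" for m m'
    using c_diff[OF that(1,2)] that unfolding inc
    by (cases "m - 1 \<in> D"; cases "m' - 1 \<in> D"; simp)
  have "inj_on (insert_inc n D) {2..Suc n}"
    by (rule inj_onI) (metis neq atLeastAtMost_iff linorder_neqE_nat)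
  moreover have "insert_inc n D ` {2..Suc n} \<subseteq> {..<n}"
  proof
    fix x assume "x \<in> insert_inc n D ` {2..Suc n}"
    then obtain m where m: "2 \<le> m" "m \<le> Suc n" "x = insert_inc n D m" by auto
    then show "x \<in> {..<n}" using c_le[of m] by (auto simp: inc)
  qed
  ultimately show ?thesis
    by (simp add: bij_betw_def card_image card_subset_eq)
qed

lemma rmaj_S_Suc:
  assumes "u \<in> Sym n" "m \<in> {1..Suc n}"
  shows "rmaj_S (Suc n) (u \<circ> s_down n m) = rmaj_S n u + insert_inc n (Des_S n u) m"
  unfolding rmaj_S_def Des_S_Suc[OF assms] using assms
  by (intro sum_insert_des) (auto simp: Des_S_def)

section \<open>Generating functions\<close>

lemma sum_over_insertions:
  fixes s d n :: nat
  assumes "bij_betw inc {2..Suc n} {..<n}"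
  shows "(\<Sum>m\<in>{2..Suc n}. monom (monom (1::int) (s + inc m)) d) =
    monom (monom 1 s) d * (\<Sum>j<n. monom (monom 1 j) 0)"
proof -
  have "(\<Sum>m\<in>{2..Suc n}. monom (monom (1::int) (s + inc m)) d) = (\<Sum>j<n. monom (monom 1 (s + j)) d)"
    by (rule sum.reindex_bij_betw[OF assms])
  then show ?thesis by (simp add: sum_distrib_left mult_monom)
qed

text \<open>The outer polynomial variable marks \<open>d\<close> and the inner one is
  \<open>q\<close>. If extending \<open>u\<close> multiplies its monomial by the same
  \<open>W n\<close> for both statistics, the bivariate generating functions agree by
  induction.\<close>

lemma equidistribution_of_chain:
  fixes \<phi> :: "'a \<Rightarrow> nat \<Rightarrow> nat" and G :: "nat \<Rightarrow> (nat \<Rightarrow> nat) set" and W :: "nat \<Rightarrow> int poly poly"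
  assumes bij: "\<And>n. n \<ge> 1 \<Longrightarrow> bij_betw (\<lambda>(u, r). u \<circ> \<phi> r) (G n \<times> R n) (G (Suc n))"
    and fin: "\<And>n. finite (G n)"
    and base: "\<And>v. s 1 v = t 1 v"
    and s: "\<And>n u. n \<ge> 1 \<Longrightarrow> u \<in> G n \<Longrightarrow>
      (\<Sum>r\<in>R n. monom (monom 1 (s (Suc n) (u \<circ> \<phi> r))) (d (Suc n) (u \<circ> \<phi> r))) =
      monom (monom 1 (s n u)) (d n u) * W n"
    and t: "\<And>n u. n \<ge> 1 \<Longrightarrow> u \<in> G n \<Longrightarrow>
      (\<Sum>r\<in>R n. monom (monom 1 (t (Suc n) (u \<circ> \<phi> r))) (d (Suc n) (u \<circ> \<phi> r))) =
      monom (monom 1 (t n u)) (d n u) * W n"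
    and "n \<ge> 1"
  shows "(\<Sum>v | v \<in> G n \<and> d n v = k. monom (1::int) (s n v)) =
    (\<Sum>v | v \<in> G n \<and> d n v = k. monom 1 (t n v))"
proof -
  \<comment> \<open>Stated for an arbitrary statistic, to be applied once to \<open>s\<close> and
    once to \<open>t\<close>.\<close>
  have gf_Suc: "(\<Sum>v\<in>G (Suc n). monom (monom 1 (s (Suc n) v)) (d (Suc n) v)) =
      (\<Sum>v\<in>G n. monom (monom 1 (s n v)) (d n v)) * W n"
    if "n \<ge> 1" and s: "\<And>u. u \<in> G n \<Longrightarrow>
      (\<Sum>r\<in>R n. monom (monom 1 (s (Suc n) (u \<circ> \<phi> r))) (d (Suc n) (u \<circ> \<phi> r))) =
      monom (monom 1 (s n u)) (d n u) * W n" for n and s :: "nat \<Rightarrow> (nat \<Rightarrow> nat) \<Rightarrow> nat"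
  proof -
    let ?X = "\<lambda>v. monom (monom (1::int) (s (Suc n) v)) (d (Suc n) v)"
    have "sum ?X (G (Suc n)) = (\<Sum>x\<in>G n \<times> R n. ?X ((\<lambda>(u, r). u \<circ> \<phi> r) x))"
      by (rule sum.reindex_bij_betw[OF bij[OF that(1)], symmetric])
    also have "\<dots> = (\<Sum>u\<in>G n. \<Sum>r\<in>R n. ?X (u \<circ> \<phi> r))"
      by (simp add: sum.cartesian_product case_prod_unfold)
    finally show ?thesis by (simp add: s sum_distrib_right)
  qed
  have eq: "(\<Sum>v\<in>G n. monom (monom (1::int) (s n v)) (d n v)) =
    (\<Sum>v\<in>G n. monom (monom 1 (t n v)) (d n v))"
    using \<open>n \<ge> 1\<close>
  proof (induction n rule: dec_induct)
    case base
    then show ?case by (simp add: assms(3)[simplified])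
  next
    case (step n)
    then show ?case
      using gf_Suc[of n s, OF step(1) s[OF step(1)]] gf_Suc[of n t, OF step(1) t[OF step(1)]] by simp
  qed
  \<comment> \<open>The coefficient of index \<open>k\<close> in the outer variable keeps exactly
    the elements with \<open>d n v = k\<close>.\<close>
  have coeff: "coeff (\<Sum>v\<in>G n. monom (monom (1::int) (s v)) (d n v)) k =
    (\<Sum>v | v \<in> G n \<and> d n v = k. monom 1 (s v))" for s
    using fin[of n] by (simp add: coeff_sum sum.inter_filter)
  show ?thesis using eq coeff[of "s n"] coeff[of "t n"] by simp
qed

section \<open>The symmetric group\<close>

lemma finite_Sym: "finite (Sym n)"
  unfolding Sym_def by (rule finite_permutations) simp

text \<open>The front position contributes the monomial that raises \<open>del_S\<close>; the other
  positions contribute each power of \<open>q\<close> below \<open>n\<close> once. The order in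
  which \<open>inc\<close> takes these values is immaterial, so \<open>len_S\<close> and
  \<open>rmaj_S\<close> get the same factor.\<close>

lemma gf_step_S:
  assumes n: "n \<ge> 1" and u: "u \<in> Sym n"
    and s: "\<And>m. m \<in> {1..Suc n} \<Longrightarrow> s (Suc n) (u \<circ> s_down n m) = s n u + inc m"
    and inc: "inc 1 = n" "bij_betw inc {2..Suc n} {..<n}"
  shows "(\<Sum>r\<in>R_S n. monom (monom (1::int) (s (Suc n) (u \<circ> r))) (del_S (Suc n) (u \<circ> r))) =
    monom (monom 1 (s n u)) (del_S n u) * (monom (monom 1 n) 1 + (\<Sum>j<n. monom (monom 1 j) 0))"
proof -
  let ?X = "\<lambda>m. monom (monom (1::int) (s (Suc n) (u \<circ> s_down n m))) (del_S (Suc n) (u \<circ> s_down n m))"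
  have "(\<Sum>r\<in>R_S n. monom (monom (1::int) (s (Suc n) (u \<circ> r))) (del_S (Suc n) (u \<circ> r))) =
    (\<Sum>m\<in>{1..Suc n}. ?X m)"
    unfolding R_S_def using sum.reindex[OF inj_on_s_down[of n]] by (simp add: comp_def del: sum.cl_ivl_Suc)
  also have "{1..Suc n} = insert 1 {2..Suc n}" by auto
  also have "(\<Sum>m\<in>insert 1 {2..Suc n}. ?X m) = ?X 1 + (\<Sum>m\<in>{2..Suc n}. ?X m)"
    by (rule sum.insert) auto
  also have "?X 1 = monom (monom 1 (s n u)) (del_S n u) * monom (monom 1 n) 1"
    using s[of 1] del_S_Suc[OF n u, of 1] inc(1) by (simp add: mult_monom)
  also have "(\<Sum>m\<in>{2..Suc n}. ?X m) = (\<Sum>m\<in>{2..Suc n}. monom (monom 1 (s n u + inc m)) (del_S n u))"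
    using s del_S_Suc[OF n u] by (intro sum.cong) auto
  finally show ?thesis
    by (simp only: sum_over_insertions[OF inc(2)] distrib_left)
qed

lemma bij_betw_reverse: "bij_betw (\<lambda>m. Suc n - m) {2..Suc n} {..<n}"
  by (rule bij_betw_byWitness[where f' = "\<lambda>j. Suc n - j"]) auto

lemma equidistribution_S:
  assumes "n \<ge> 1"
  shows "(\<Sum>\<sigma>\<in>B_S n k. monom (1::int) (len_S n \<sigma>)) = (\<Sum>\<sigma>\<in>B_S n k. monom 1 (rmaj_S n \<sigma>))"
  unfolding B_S_def
proof (rule equidistribution_of_chain[where G = Sym and R = R_S and \<phi> = "\<lambda>r. r",
      OF bij_betw_Sym_Suc finite_Sym _ _ _ assms])
  show "len_S 1 v = rmaj_S 1 v" for v
    by (simp add: len_S_eq_sum inv_at_def rmaj_S_def Des_S_def)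
  show "(\<Sum>r\<in>R_S n. monom (monom (1::int) (len_S (Suc n) (u \<circ> r))) (del_S (Suc n) (u \<circ> r))) =
      monom (monom 1 (len_S n u)) (del_S n u) * (monom (monom 1 n) 1 + (\<Sum>j<n. monom (monom 1 j) 0))"
    if "n \<ge> 1" "u \<in> Sym n" for n u
    using that len_S_Suc bij_betw_reverse
    by (intro gf_step_S[where s = len_S and inc = "\<lambda>m. Suc n - m"]) simp_all
  show "(\<Sum>r\<in>R_S n. monom (monom (1::int) (rmaj_S (Suc n) (u \<circ> r))) (del_S (Suc n) (u \<circ> r))) =
      monom (monom 1 (rmaj_S n u)) (del_S n u) * (monom (monom 1 n) 1 + (\<Sum>j<n. monom (monom 1 j) 0))"
    if "n \<ge> 1" "u \<in> Sym n" for n u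
  proof -
    have "Des_S n u \<subseteq> {1..<n}" by (auto simp: Des_S_def)
    then show ?thesis
      using that rmaj_S_Suc insert_inc_1 bij_betw_insert_inc
      by (intro gf_step_S[where s = rmaj_S and inc = "insert_inc n (Des_S n u)"]) simp_all
  qed
qed

section \<open>Canonical words of the alternating group as insertions\<close>

text \<open>The words of \<open>R_A j\<close> indexed by the position at which they insert the value \<open>j + 2\<close>.\<close>

definition a_word :: "nat \<Rightarrow> nat \<Rightarrow> letter list" where
  "a_word j p = (if p = 1 then a_down j 2 @ [Gen_inv 1] else a_down j (p - 1))"

lemma a_down_1: "j \<ge> 1 \<Longrightarrow> a_down j 1 = a_down j 2 @ [Gen 1]"
  by (simp add: a_down_def upt_conv_Cons numeral_2_eq_2 del: upt_Suc)

lemma R_A_eq_image: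
  assumes "j \<ge> 1"
  shows "R_A j = a_word j ` {1..Suc (Suc j)}"
proof -
  \<comment> \<open>Positions 1 and 2 belong to the two words ending in the inverse of
    \<open>a_gen 1\<close> and in \<open>a_gen 1\<close>; the other words \<open>a_down j m\<close>
    sit at position \<open>Suc m\<close>.\<close>
  have "{1..Suc (Suc j)} = insert 1 (insert 2 (Suc ` {2..j + 1}))"
    by (auto simp: image_Suc_atLeastAtMost)
  moreover have "a_word j ` Suc ` {2..j + 1} = a_down j ` {2..j + 1}"
    unfolding image_image by (rule image_cong) (auto simp: a_word_def)
  moreover have "a_word j 1 = a_down j 2 @ [Gen_inv 1]" "a_word j 2 = a_down j 2 @ [Gen 1]"
    using a_down_1[OF assms] by (simp_all add: a_word_def)
  ultimately show ?thesis
    unfolding R_A_def by (simp only: image_insert) blast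
qed

lemma length_a_down: "length (a_down j m) = Suc j - m"
  by (simp add: a_down_def del: upt_Suc)

lemma length_a_word:
  assumes "j \<ge> 1" "p \<in> {1..Suc (Suc j)}"
  shows "length (a_word j p) = Suc (Suc j) - max p 2"
  using assms by (auto simp: a_word_def length_a_down max_def)

lemma filter_a_word:
  assumes "j \<ge> 1" "p \<in> {1..Suc (Suc j)}"
  shows "length (filter (\<lambda>x. x \<in> {Gen 1, Gen_inv 1}) (a_word j p)) = (if p \<le> 2 then 1 else 0)"
proof -
  have *: "filter (\<lambda>x. x \<in> {Gen 1, Gen_inv 1}) (a_down j m) = []" if "m \<ge> 2" for m
    using that by (auto simp: a_down_def filter_empty_conv)
  consider "p = 1" | "p = 2" | "p \<ge> 3" using assms by fastforce
  then show ?thesis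
  proof cases
    case 1
    then show ?thesis using *[of 2] by (simp add: a_word_def)
  next
    case 2
    then show ?thesis using *[of 2] a_down_1[OF assms(1)] by (simp add: a_word_def)
  next
    case 3
    then show ?thesis using *[of "p - 1"] by (simp add: a_word_def)
  qed
qed

section \<open>Collecting the factors \<open>s_gen 1\<close> on the left\<close>

lemma s_gen_commute: "i \<ge> 3 \<Longrightarrow> s_gen i \<circ> s_gen 1 = s_gen 1 \<circ> s_gen i"
  by (auto simp: s_gen_def transpose_def fun_eq_iff)

lemma s_gen_commute_funpow: "i \<ge> 3 \<Longrightarrow> s_gen i \<circ> (s_gen 1 ^^ e) = (s_gen 1 ^^ e) \<circ> s_gen i"
proof (induction e)
  case (Suc e)
  have "s_gen i \<circ> (s_gen 1 ^^ Suc e) = (s_gen i \<circ> s_gen 1) \<circ> (s_gen 1 ^^ e)"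
    by (simp add: comp_assoc)
  also have "\<dots> = s_gen 1 \<circ> (s_gen i \<circ> (s_gen 1 ^^ e))"
    by (simp only: s_gen_commute[OF Suc.prems] comp_assoc)
  finally show ?case
    by (simp only: Suc.IH[OF Suc.prems] funpow.simps comp_assoc)
qed simp

lemma word_perm_Nil [simp]: "word_perm [] = id"
  by (simp add: word_perm_def)

lemma word_perm_Cons: "word_perm (x # w) = letter_perm x \<circ> word_perm w"
  by (simp add: word_perm_def)

lemma word_perm_append: "word_perm (v @ w) = word_perm v \<circ> word_perm w"
  by (simp add: word_perm_def)

text \<open>Each letter \<open>Gen i\<close> stands for
  \<open>s_gen 1 \<circ> s_gen (i + 1)\<close>. All factors \<open>s_gen 1\<close> can be moved to
  the left, since \<open>s_gen 2\<close> is the only generator in the word that blocks them and it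
  can occur only at the right end.\<close>

lemma word_perm_a_down:
  assumes "1 \<le> m" "m \<le> Suc j"
  shows "word_perm (a_down j m) = (s_gen 1 ^^ (Suc j - m)) \<circ> s_down (Suc j) (Suc m)"
  using assms(2)
proof (induction j)
  case 0
  then have "m = 1" using assms(1) by simp
  then show ?case by (simp add: a_down_def id_def[symmetric])
next
  case (Suc j)
  show ?case
  proof (cases "m = Suc (Suc j)")
    case True
    then show ?thesis by (simp add: a_down_def id_def[symmetric])
  next
    case False
    let ?e = "Suc j - m"
    have m: "m \<le> Suc j" using False Suc.prems by simp
    have "a_down (Suc j) m = Gen (Suc j) # a_down j m"
      using m by (simp add: a_down_def)
    then have "word_perm (a_down (Suc j) m) =
      s_gen 1 \<circ> (s_gen (Suc (Suc j)) \<circ> (s_gen 1 ^^ ?e)) \<circ> s_down (Suc j) (Suc m)"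
      by (simp only: word_perm_Cons letter_perm.simps a_gen_def Suc.IH[OF m] comp_assoc add_Suc_right
          One_nat_def add_0_right)
    also have "s_gen (Suc (Suc j)) \<circ> (s_gen 1 ^^ ?e) = (s_gen 1 ^^ ?e) \<circ> s_gen (Suc (Suc j))"
    \<comment> \<open>For \<open>j = 0\<close> the generator is \<open>s_gen 2\<close>, which does
      not commute with \<open>s_gen 1\<close>, but then there is no factor \<open>s_gen 1\<close> to
      pass.\<close>
    proof (cases "j = 0")
      case True
      then have "?e = 0" using assms(1) by simp
      then show ?thesis by (simp only: funpow.simps id_comp comp_id)
    qed (use s_gen_commute_funpow[of "Suc (Suc j)" ?e] in simp)
    also have "s_gen 1 \<circ> ((s_gen 1 ^^ ?e) \<circ> s_gen (Suc (Suc j))) \<circ> s_down (Suc j) (Suc m) =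
      (s_gen 1 ^^ Suc ?e) \<circ> (s_gen (Suc (Suc j)) \<circ> s_down (Suc j) (Suc m))"
      by (simp only: funpow.simps comp_assoc)
    also have "s_gen (Suc (Suc j)) \<circ> s_down (Suc j) (Suc m) = s_down (Suc (Suc j)) (Suc m)"
      using m by (intro s_down_Suc[symmetric]) simp
    also have "Suc ?e = Suc (Suc j) - m" using m by simp
    finally show ?thesis .
  qed
qed

lemma inv_a_gen: "inv (a_gen i) = s_gen (i + 1) \<circ> s_gen 1"
proof (rule inv_unique_comp)
  have "a_gen i \<circ> (s_gen (i + 1) \<circ> s_gen 1) = s_gen 1 \<circ> (s_gen (i + 1) \<circ> s_gen (i + 1)) \<circ> s_gen 1"
    by (simp only: a_gen_def comp_assoc)
  then show "a_gen i \<circ> (s_gen (i + 1) \<circ> s_gen 1) = id" by (simp only: s_gen_s_gen comp_id)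
  have "s_gen (i + 1) \<circ> s_gen 1 \<circ> a_gen i = s_gen (i + 1) \<circ> (s_gen 1 \<circ> s_gen 1) \<circ> s_gen (i + 1)"
    by (simp only: a_gen_def comp_assoc)
  then show "s_gen (i + 1) \<circ> s_gen 1 \<circ> a_gen i = id" by (simp only: s_gen_s_gen comp_id)
qed

lemma s_gen_funpow_cases: "s_gen 1 ^^ e = id \<or> s_gen 1 ^^ e = s_gen 1"
proof (induction e)
  case (Suc e)
  then show ?case
    by (elim disjE) (simp_all only: funpow.simps comp_id s_gen_s_gen simp_thms)
qed (simp only: funpow.simps simp_thms)

text \<open>For \<open>p = 1\<close> the inverse of \<open>a_gen 1\<close>, which is
  \<open>s_gen 2 \<circ> s_gen 1\<close>, completes the descending product down to
  \<open>s_gen 1\<close>; for larger \<open>p\<close> the word is \<open>a_down j (p - 1)\<close>.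
  In both cases the collected power of the involution \<open>s_gen 1\<close> reduces to
  \<open>x\<close>.\<close>

lemma word_perm_a_word:
  assumes j: "j \<ge> 1" and p: "p \<in> {1..Suc (Suc j)}"
  obtains x where "x = id \<or> x = s_gen 1" "word_perm (a_word j p) = x \<circ> s_down (Suc j) p"
proof (cases "p = 1")
  case True
  have "word_perm (a_word j p) = (s_gen 1 ^^ (j - 1)) \<circ> (s_down (Suc j) (Suc 2) \<circ> s_gen 2 \<circ> s_gen 1)"
    using True word_perm_a_down[of 2 j] j inv_a_gen[of 1]
    by (simp add: a_word_def word_perm_append word_perm_Cons comp_assoc numeral_2_eq_2)
  also have "s_down (Suc j) (Suc 2) \<circ> s_gen 2 = s_down (Suc j) 2"
    using j by (intro s_down_unfold_right[symmetric]) simp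
  also have "s_down (Suc j) 2 \<circ> s_gen 1 = s_down (Suc j) p"
    using True s_down_unfold_right[of 1 "Suc j"] by (simp add: numeral_2_eq_2)
  finally show ?thesis using that s_gen_funpow_cases by blast
next
  case False
  then have "word_perm (a_word j p) = (s_gen 1 ^^ (Suc j - (p - 1))) \<circ> s_down (Suc j) p"
    using word_perm_a_down[of "p - 1" j] p by (auto simp: a_word_def Suc_diff_Suc)
  then show ?thesis using that s_gen_funpow_cases by blast
qed

lemma s_gen_1_permutes: "n \<ge> 1 \<Longrightarrow> x = id \<or> x = s_gen 1 \<Longrightarrow> x permutes {1..Suc n}"
  using s_gen_permutes[of 1 "Suc n"] permutes_id by auto

lemma word_perm_a_word_permutes:
  assumes "j \<ge> 1" "p \<in> {1..Suc (Suc j)}"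
  shows "word_perm (a_word j p) permutes {1..Suc (Suc j)}"
    and "word_perm (a_word j p) p = Suc (Suc j)"
proof -
  obtain x where x: "x = id \<or> x = s_gen 1" "word_perm (a_word j p) = x \<circ> s_down (Suc j) p"
    using word_perm_a_word[OF assms] .
  show "word_perm (a_word j p) permutes {1..Suc (Suc j)}"
    unfolding x(2) using assms x(1) s_down_permutes[of p "Suc j"] s_gen_1_permutes[of "Suc j" x]
    by (intro permutes_compose) auto
  \<comment> \<open>As \<open>j \<ge> 1\<close>, the maximum is at least 3 and
    \<open>s_gen 1\<close> does not move it.\<close>
  have "x (Suc (Suc j)) = Suc (Suc j)"
    using x(1) assms(1) by (auto simp: s_gen_def transpose_def)
  then show "word_perm (a_word j p) p = Suc (Suc j)"
    unfolding x(2) using assms(2) by (simp add: s_down_apply)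
qed

section \<open>The canonical factorization in the alternating group\<close>

lemma even_a_gen: "permutation (a_gen i) \<and> evenperm (a_gen i)"
  by (simp add: a_gen_def s_gen_def permutation_compose permutation_swap_id evenperm_comp evenperm_swap)

lemma even_word_perm: "permutation (word_perm w) \<and> evenperm (word_perm w)"
proof (induction w)
  case (Cons x w)
  have "permutation (letter_perm x) \<and> evenperm (letter_perm x)"
    using even_a_gen by (cases x) (auto simp: evenperm_inv permutation_inverse)
  then show ?case
    using Cons by (simp only: word_perm_Cons permutation_compose evenperm_comp)
qed (simp add: permutation_id evenperm_id)

text \<open>The position of the maximum in the permutation of a word recovers
  \<open>p\<close>.\<close>

lemma inj_on_a_word: "j \<ge> 1 \<Longrightarrow> inj_on (a_word j) {1..Suc (Suc j)}"
proof (rule inj_onI)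
  fix p q assume j: "j \<ge> 1" and pq: "p \<in> {1..Suc (Suc j)}" "q \<in> {1..Suc (Suc j)}" "a_word j p = a_word j q"
  have "inj (word_perm (a_word j p))"
    using word_perm_a_word_permutes(1)[OF j pq(1)] by (rule permutes_inj)
  moreover have "word_perm (a_word j p) p = word_perm (a_word j p) q"
    using word_perm_a_word_permutes(2)[OF j pq(1)] word_perm_a_word_permutes(2)[OF j pq(2)] pq(3) by simp
  ultimately show "p = q" by (rule injD)
qed

lemma permutes_imp_permutation: "p permutes {1..n::nat} \<Longrightarrow> permutation p"
  by (auto simp: permutation_permutes)

lemma bij_betw_Alt_Suc:
  assumes n: "n \<ge> 1"
  shows "bij_betw (\<lambda>(u, r). u \<circ> word_perm r) (Alt (n + 1) \<times> R_A n) (Alt (Suc n + 1))"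
proof -
  let ?pos = "the_inv_into {1..Suc (Suc n)} (a_word n)"
  have "bij_betw ?pos (R_A n) {1..Suc (Suc n)}"
    unfolding R_A_eq_image[OF n] using inj_on_a_word[OF n]
    by (simp add: bij_betw_the_inv_into inj_on_imp_bij_betw)
  moreover have "word_perm r permutes {1..Suc (Suc n)} \<and> evenperm (word_perm r) \<and>
      word_perm r (?pos r) = Suc (Suc n)" if "r \<in> R_A n" for r
    using that inj_on_a_word[OF n] word_perm_a_word_permutes[OF n] even_word_perm
    unfolding R_A_eq_image[OF n] by (auto simp: the_inv_into_f_f)
  ultimately show ?thesis
    using bij_betw_coset_representatives[of "R_A n" word_perm "Suc n" evenperm ?pos]
    by (simp add: Alt_def evenperm_comp evenperm_inv permutes_imp_permutation)
qed

lemma Alt_2: "Alt (1 + 1) = {id}"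
proof -
  have "v = id" if v: "v permutes {1..2}" "evenperm v" for v :: "nat \<Rightarrow> nat"
  proof -
    have "{1..2} = {1, 2::nat}" by auto
    then have "v = id \<or> v = transpose 1 2"
      using v(1) by (simp add: permutes_doubleton_iff)
    then show ?thesis using v(2) evenperm_swap[of 1 "2::nat"] by auto
  qed
  then show ?thesis by (auto simp: Alt_def permutes_id numeral_2_eq_2)
qed

lemma fact_A_Suc:
  assumes "n \<ge> 1" "u \<in> Alt (n + 1)" "r \<in> R_A n"
  shows "fact_A (Suc n) (u \<circ> word_perm r) = (fact_A n u)(n := r)"
  using factorization_step[of "\<lambda>n. Alt (n + 1)" word_perm R_A fact_A, OF Alt_2 bij_betw_Alt_Suc _ assms]
  by (simp add: fact_A_def)

lemma sum_fact_A_Suc: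
  assumes "n \<ge> 1" "u \<in> Alt (n + 1)" "r \<in> R_A n"
  shows "(\<Sum>j = 1..Suc n - 1. f (fact_A (Suc n) (u \<circ> word_perm r) j)) =
    (\<Sum>j = 1..n - 1. f (fact_A n u j)) + (f r :: nat)"
proof -
  have "{1..Suc n - 1} = insert n {1..n - 1}" using assms by auto
  then have "(\<Sum>j = 1..Suc n - 1. f (((fact_A n u)(n := r)) j)) =
    f r + (\<Sum>j = 1..n - 1. f (((fact_A n u)(n := r)) j))"
    using assms(1) by simp
  also have "(\<Sum>j = 1..n - 1. f (((fact_A n u)(n := r)) j)) = (\<Sum>j = 1..n - 1. f (fact_A n u j))"
    using assms(1) by (intro sum.cong) auto
  finally show ?thesis by (simp only: fact_A_Suc[OF assms] add.commute)
qed

lemma len_A_Suc: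
  assumes "n \<ge> 1" "u \<in> Alt (n + 1)" "p \<in> {1..Suc (Suc n)}"
  shows "len_A (Suc n) (u \<circ> word_perm (a_word n p)) = len_A n u + (Suc (Suc n) - max p 2)"
proof -
  have "a_word n p \<in> R_A n" using assms R_A_eq_image by auto
  from sum_fact_A_Suc[OF assms(1,2) this, of length] show ?thesis
    unfolding len_A_def by (simp only: length_a_word[OF assms(1,3)])
qed

lemma del_A_Suc:
  assumes "n \<ge> 1" "u \<in> Alt (n + 1)" "p \<in> {1..Suc (Suc n)}"
  shows "del_A (Suc n) (u \<circ> word_perm (a_word n p)) = del_A n u + (if p \<le> 2 then 1 else 0)"
proof -
  have "a_word n p \<in> R_A n" using assms R_A_eq_image by auto
  from sum_fact_A_Suc[OF assms(1,2) this, of "\<lambda>w. length (filter (\<lambda>x. x \<in> {Gen 1, Gen_inv 1}) w)"]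
  show ?thesis
    unfolding del_A_def by (simp only: filter_a_word[OF assms(1,3)])
qed

section \<open>Length and descents in the alternating group\<close>

text \<open>Swapping the first two entries of the one-line notation changes neither of the following two
  statistics; hence the power of \<open>s\<^sub>1\<close> in front of an insertion can be ignored.\<close>

definition alt_len :: "nat \<Rightarrow> (nat \<Rightarrow> nat) \<Rightarrow> nat" where
  "alt_len n \<sigma> = (\<Sum>j = 1..Suc n. min (inv_at \<sigma> j) (j - 2))"

definition alt_des :: "(nat \<Rightarrow> nat) \<Rightarrow> nat \<Rightarrow> bool" where
  "alt_des \<sigma> i \<longleftrightarrow> \<sigma> (Suc i) > \<sigma> (Suc (Suc i)) \<or> (\<forall>k\<in>{1..i}. \<sigma> k > \<sigma> (Suc (Suc i)))"

text \<open>The two swapped positions lie both inside or both outside the prefix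
  \<open>{1..<j}\<close>, so the swap only permutes the positions being counted.\<close>

lemma card_prefix_s_gen:
  assumes "1 \<le> p" "j \<le> p \<or> Suc p < j"
  shows "card {i \<in> {1..<j}. (\<sigma> \<circ> s_gen p) i > c} = card {i \<in> {1..<j}. \<sigma> i > (c::nat)}"
proof (rule bij_betw_same_card[of "s_gen p"], rule bij_betw_byWitness[where f' = "s_gen p"])
  have 1: "s_gen p (s_gen p i) = i" for i
    by (simp add: s_gen_def)
  have 2: "s_gen p i \<in> {1..<j}" if "i \<in> {1..<j}" for i
    using that assms by (auto simp: s_gen_def transpose_def)
  show "\<forall>a\<in>{i \<in> {1..<j}. (\<sigma> \<circ> s_gen p) i > c}. s_gen p (s_gen p a) = a"
    "\<forall>a\<in>{i \<in> {1..<j}. \<sigma> i > c}. s_gen p (s_gen p a) = a"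
    using 1 by auto
  show "s_gen p ` {i \<in> {1..<j}. (\<sigma> \<circ> s_gen p) i > c} \<subseteq> {i \<in> {1..<j}. \<sigma> i > c}"
    "s_gen p ` {i \<in> {1..<j}. \<sigma> i > c} \<subseteq> {i \<in> {1..<j}. (\<sigma> \<circ> s_gen p) i > c}"
    using 1 2 by auto
qed

lemma s_gen_apply_other: "i \<noteq> p \<Longrightarrow> i \<noteq> Suc p \<Longrightarrow> s_gen p i = i"
  by (simp add: s_gen_def)

lemma inv_at_s_gen_other:
  assumes "1 \<le> p" "j \<noteq> p" "j \<noteq> Suc p"
  shows "inv_at (\<sigma> \<circ> s_gen p) j = inv_at \<sigma> j"
proof -
  have "(\<sigma> \<circ> s_gen p) j = \<sigma> j" using assms s_gen_apply_other by simp
  moreover have "j \<le> p \<or> Suc p < j" using assms by auto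
  ultimately show ?thesis
    unfolding inv_at_def by (simp only: card_prefix_s_gen[OF assms(1)])
qed

text \<open>The cap \<open>j - 2\<close> kills the terms of the two swapped positions, and every
  later entry sees the same set of earlier entries.\<close>

lemma alt_len_s_gen_1: "alt_len n (\<sigma> \<circ> s_gen 1) = alt_len n \<sigma>"
  unfolding alt_len_def
proof (rule sum.cong)
  fix j assume "j \<in> {1..Suc n}"
  then consider "j = 1" | "j = 2" | "j \<noteq> 1" "j \<noteq> Suc 1" by fastforce
  then show "min (inv_at (\<sigma> \<circ> s_gen 1) j) (j - 2) = min (inv_at \<sigma> j) (j - 2)"
    by cases (simp_all add: inv_at_s_gen_other)
qed simp

text \<open>For \<open>i = 1\<close> the condition says that one of the first two entries exceeds
  the third, which is symmetric in them. For larger \<open>i\<close> the swap permutes the prefix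
  \<open>{1..i}\<close> and fixes the two positions after it.\<close>

lemma alt_des_s_gen_1:
  assumes "i \<ge> 1"
  shows "alt_des (\<sigma> \<circ> s_gen 1) i \<longleftrightarrow> alt_des \<sigma> i"
proof (cases "i = 1")
  case True
  then show ?thesis by (auto simp: alt_des_def s_gen_def transpose_def)
next
  case False
  have s: "s_gen 1 (s_gen 1 k) = k" for k by (simp add: s_gen_def)
  have "(\<forall>k\<in>{1..i}. \<sigma> (s_gen 1 k) > c) \<longleftrightarrow> (\<forall>k\<in>{1..i}. \<sigma> k > c)" for c
  proof -
    have "s_gen 1 k \<in> {1..i}" if "k \<in> {1..i}" for k
      using that False assms by (auto simp: s_gen_def transpose_def)
    then show ?thesis using s by metis
  qed
  then show ?thesis
    using False assms by (simp add: alt_des_def s_gen_apply_other)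
qed

text \<open>Left of the insertion nothing changes. A maximum at \<open>Suc (Suc i)\<close> makes
  both alternatives of \<open>alt_des\<close> fail; at \<open>Suc i\<close>, or at 1 with
  \<open>i = 1\<close>, it makes one of them true. Further right all indices shift, and the maximum
  joins the prefix, where it satisfies the comparison automatically.\<close>

lemma alt_des_insert_max:
  assumes u: "u \<in> Sym (Suc n)" and p: "p \<in> {1..Suc (Suc n)}" and i: "1 \<le> i" "i \<le> n"
  defines "v \<equiv> u \<circ> s_down (Suc n) p"
  shows "Suc (Suc i) < p \<Longrightarrow> alt_des v i \<longleftrightarrow> alt_des u i"
    and "Suc (Suc i) = p \<Longrightarrow> \<not> alt_des v i"
    and "Suc i = p \<or> i = 1 \<and> p = 1 \<Longrightarrow> alt_des v i"
    and "p \<le> i \<Longrightarrow> 2 \<le> i \<Longrightarrow> alt_des v i \<longleftrightarrow> alt_des u (i - 1)"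
proof -
  note v = insert_max_apply[OF u p, folded v_def]
  have u_le: "u k < Suc (Suc n)" if "k \<le> Suc n" for k
    using Sym_le[OF u that] by simp
  show "alt_des v i \<longleftrightarrow> alt_des u i" if "Suc (Suc i) < p"
    using that v(2) by (auto simp: alt_des_def)
  show "\<not> alt_des v i" if "Suc (Suc i) = p"
  proof -
    have "v (Suc (Suc i)) = Suc (Suc n)" "v (Suc i) < Suc (Suc n)" "v 1 < Suc (Suc n)"
      using that v(1) v(2)[of "Suc i"] v(2)[of 1] i u_le[of "Suc i"] u_le[of 1] by auto
    then show ?thesis using i by (auto simp: alt_des_def intro!: bexI[of _ 1])
  qed
  show "alt_des v i" if "Suc i = p \<or> i = 1 \<and> p = 1"
    using that
  proof
    assume "Suc i = p"
    then show ?thesis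
      using v(1) v(3)[of "Suc i"] i u_le[of "Suc i"] by (auto simp: alt_des_def)
  next
    assume "i = 1 \<and> p = 1"
    then show ?thesis
      using v(1) v(3)[of 2] i u_le[of 2] by (auto simp: alt_des_def numeral_2_eq_2)
  qed
  show "alt_des v i \<longleftrightarrow> alt_des u (i - 1)" if "p \<le> i" "2 \<le> i"
  proof -
    obtain l where l: "i = Suc l" using i by (cases i) auto
    have v_top: "v (Suc i) = u i" "v (Suc (Suc i)) = u (Suc i)"
      using v(3)[of i] v(3)[of "Suc i"] that i by auto
    have "(\<forall>k\<in>{1..Suc l}. v k > u (Suc i)) \<longleftrightarrow> (\<forall>k\<in>{1..l}. u k > u (Suc i))"
    proof
      assume *: "\<forall>k\<in>{1..Suc l}. v k > u (Suc i)"
      show "\<forall>k\<in>{1..l}. u k > u (Suc i)"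
      proof
        fix k assume k: "k \<in> {1..l}"
        show "u k > u (Suc i)"
          using *[rule_format, of k] *[rule_format, of "Suc k"] v(2)[of k] v(3)[of k] k l i
          by (cases "k < p") auto
      qed
    next
      assume *: "\<forall>k\<in>{1..l}. u k > u (Suc i)"
      show "\<forall>k\<in>{1..Suc l}. v k > u (Suc i)"
      proof
        fix k assume k: "k \<in> {1..Suc l}"
        consider "k < p" | "k = p" | "k > p" by linarith
        then show "v k > u (Suc i)"
        proof cases
          case 1
          then show ?thesis using *[rule_format, of k] v(2)[of k] k that l by auto
        next
          case 2
          then show ?thesis using v(1) u_le[of "Suc i"] i by simp
        next
          case 3
          then obtain k' where "k = Suc k'" by (cases k) auto
          then show ?thesis using 3 *[rule_format, of k'] v(3)[of k'] k l i p by auto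
        qed
      qed
    qed
    then show ?thesis using v_top l by (simp add: alt_des_def)
  qed
qed

text \<open>An index \<open>i\<close> of \<open>alt_des\<close> refers to positions
  \<open>Suc i\<close> and \<open>Suc (Suc i)\<close>, hence the shift to \<open>p - 1\<close>;
  positions 1 and 2 both act as the front, hence the maximum with 1.\<close>

lemma alt_des_set_insert_max:
  assumes u: "u \<in> Sym (Suc n)" and p: "p \<in> {1..Suc (Suc n)}" and n: "n \<ge> 1"
  shows "{i \<in> {1..Suc n - 1}. alt_des (u \<circ> s_down (Suc n) p) i} =
    insert_des n (max 1 (p - 1)) {i \<in> {1..n - 1}. alt_des u i}"
proof (rule set_eqI)
  fix i
  show "i \<in> {i \<in> {1..Suc n - 1}. alt_des (u \<circ> s_down (Suc n) p) i} \<longleftrightarrow>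
    i \<in> insert_des n (max 1 (p - 1)) {i \<in> {1..n - 1}. alt_des u i}"
  proof (cases "1 \<le> i \<and> i \<le> n")
    case False
    then show ?thesis using n p by (auto simp: insert_des_def)
  next
    case True
    then have i: "1 \<le> i" "i \<le> n" by auto
    note des = alt_des_insert_max[OF u p i]
    consider "Suc (Suc i) < p" | "Suc (Suc i) = p" | "Suc i = p \<or> i = 1 \<and> p = 1" | "p \<le> i" "2 \<le> i"
      using i p by fastforce
    then show ?thesis
    proof cases
      case 1
      then show ?thesis using des(1) i p by (auto simp: insert_des_def max_def)
    next
      case 2
      then show ?thesis using des(2) i p by (auto simp: insert_des_def max_def)
    next
      case 3
      then show ?thesis using des(3) i p by (auto simp: insert_des_def max_def)
    next
      case 4
      then obtain l where "i = Suc l" by (cases i) auto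
      then show ?thesis using 4 des(4) i p by (auto simp: insert_des_def max_def)
    qed
  qed
qed

text \<open>Pushing an entry from position \<open>j\<close> to \<open>Suc j\<close> raises both its
  inversion count and its cap by one, except for \<open>j = 1\<close>, where truncated subtraction
  leaves the cap at 0.\<close>

lemma alt_len_insert_max:
  assumes u: "u \<in> Sym (Suc n)" and p: "p \<in> {1..Suc (Suc n)}"
  shows "alt_len (Suc n) (u \<circ> s_down (Suc n) p) = alt_len n u + (Suc (Suc n) - max p 2)"
proof -
  let ?v = "u \<circ> s_down (Suc n) p"
  note v = inv_at_insert_max[OF u p]
  have "(\<Sum>j = 1..Suc (Suc n). min (inv_at ?v j) (j - 2)) =
    (\<Sum>j = 1..Suc n. min (inv_at u j) (j - 2)) + (\<Sum>j = p..Suc n. if 2 \<le> j then 1 else 0)"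
  proof (rule sum_insertion[OF p])
    show "min (inv_at ?v j) (j - 2) = min (inv_at u j) (j - 2)" if "j < p" for j
      using v(1)[OF that] by simp
    show "min (inv_at ?v p) (p - 2) = 0" using v(2) by simp
    show "min (inv_at ?v (Suc j)) (Suc j - 2) = min (inv_at u j) (j - 2) + (if 2 \<le> j then 1 else 0)"
      if "p \<le> j" "j \<le> Suc n" for j
      using v(3)[OF that] that p by (auto simp: min_def)
  qed
  moreover have "(\<Sum>j = p..Suc n. if 2 \<le> j then 1 else 0) = card {max p 2..Suc n}"
  proof -
    have "{p..Suc n} \<inter> {j. 2 \<le> j} = {max p 2..Suc n}" by auto
    then show ?thesis by (simp add: sum.If_cases del: sum.cl_ivl_Suc)
  qed
  ultimately show ?thesis by (simp add: alt_len_def del: sum.cl_ivl_Suc)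
qed

section \<open>Transfer to \<open>len_A\<close> and \<open>Des_A\<close>\<close>

lemma Alt_subset_Sym: "v \<in> Alt n \<Longrightarrow> v \<in> Sym n"
  by (simp add: Alt_def Sym_def)

text \<open>The power of \<open>s_gen 1\<close> is absorbed into \<open>u\<close>. The resulting
  \<open>w\<close> may be odd, which is why the insertion lemmas for \<open>alt_len\<close> and
  \<open>alt_des\<close> are stated over \<open>Sym\<close>.\<close>

lemma word_perm_insert_max:
  assumes "n \<ge> 1" "u \<in> Alt (n + 1)" "p \<in> {1..Suc (Suc n)}"
  obtains w where "w \<in> Sym (Suc n)" "w = u \<or> w = u \<circ> s_gen 1"
    "u \<circ> word_perm (a_word n p) = w \<circ> s_down (Suc n) p"
proof -
  obtain x where x: "x = id \<or> x = s_gen 1" "word_perm (a_word n p) = x \<circ> s_down (Suc n) p"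
    using word_perm_a_word[OF assms(1,3)] .
  have "u \<circ> x \<in> Sym (Suc n)"
    using Alt_subset_Sym[OF assms(2)] s_gen_1_permutes[OF assms(1) x(1)] permutes_compose[of x _ u]
    by (simp only: Sym_def mem_Collect_eq Suc_eq_plus1)
  moreover have "u \<circ> x = u \<or> u \<circ> x = u \<circ> s_gen 1"
    using x(1) by (elim disjE) (simp_all only: comp_id simp_thms)
  moreover have "u \<circ> word_perm (a_word n p) = (u \<circ> x) \<circ> s_down (Suc n) p"
    by (simp only: x(2) comp_assoc)
  ultimately show ?thesis using that by blast
qed

text \<open>Both sides grow by \<open>Suc (Suc n) - max p 2\<close> when the canonical word at
  position \<open>p\<close> is appended; on the right this uses the invariance under
  \<open>s_gen 1\<close>.\<close>

lemma len_A_eq_alt_len: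
  assumes "n \<ge> 1" "v \<in> Alt (n + 1)"
  shows "len_A n v = alt_len n v"
  using assms
proof (induction n arbitrary: v rule: dec_induct)
  case base
  have "min (inv_at v j) (j - 2) = 0" if "j \<in> {1..Suc 1}" for j using that by auto
  then show ?case unfolding len_A_def alt_len_def by simp
next
  case (step n)
  have "v \<in> (\<lambda>(u, r). u \<circ> word_perm r) ` (Alt (n + 1) \<times> R_A n)"
    using bij_betw_imp_surj_on[OF bij_betw_Alt_Suc[OF step(1)]] step.prems by simp
  then obtain u p where u: "u \<in> Alt (n + 1)" "p \<in> {1..Suc (Suc n)}"
    "v = u \<circ> word_perm (a_word n p)"
    unfolding R_A_eq_image[OF step(1)] by auto
  obtain w where w: "w \<in> Sym (Suc n)" "w = u \<or> w = u \<circ> s_gen 1"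
    "u \<circ> word_perm (a_word n p) = w \<circ> s_down (Suc n) p"
    using word_perm_insert_max[OF step(1) u(1,2)] .
  have "alt_len n w = alt_len n u" using w(2) alt_len_s_gen_1 by auto
  then show ?case
    unfolding u(3) w(3) len_A_Suc[OF step(1) u(1,2), unfolded w(3)] alt_len_insert_max[OF w(1) u(2)]
    using step.IH[OF u(1)] by simp
qed

text \<open>Only the terms at \<open>p\<close> and \<open>Suc p\<close> change. At a descent the
  swap never increases the length. At an ascent the entry moved right gains exactly one, and the
  entry moved left loses one exactly when its count \<open>B\<close> equals \<open>p - 1\<close>,
  that is, when all earlier entries exceed it.\<close>

lemma alt_len_s_gen_le_iff:
  assumes p: "2 \<le> p" "p \<le> n" and \<tau>: "\<tau> p \<noteq> \<tau> (Suc p)"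
  shows "alt_len n (\<tau> \<circ> s_gen p) \<le> alt_len n \<tau> \<longleftrightarrow>
    \<tau> p > \<tau> (Suc p) \<or> (\<forall>k\<in>{1..<p}. \<tau> k > \<tau> (Suc p))"
proof -
  define A where "A = card {i \<in> {1..<p}. \<tau> i > \<tau> p}"
  define B where "B = card {i \<in> {1..<p}. \<tau> i > \<tau> (Suc p)}"
  let ?v = "\<tau> \<circ> s_gen p"
  have v: "?v p = \<tau> (Suc p)" "?v (Suc p) = \<tau> p" by (simp_all add: s_gen_def)
  have split: "{i \<in> {1..<Suc p}. f i > c} = {i \<in> {1..<p}. f i > c} \<union> (if f p > c then {p} else {})"
    for f and c :: nat using p by (auto simp: less_Suc_eq)
  have card_split: "card {i \<in> {1..<Suc p}. f i > c} = card {i \<in> {1..<p}. f i > c} + (if f p > c then 1 else 0)"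
    for f and c :: nat unfolding split by (subst card_Un_disjoint) auto
  have prefix: "card {i \<in> {1..<p}. ?v i > c} = card {i \<in> {1..<p}. \<tau> i > c}" for c
    using card_prefix_s_gen[of p p] p by simp
  have inv: "inv_at \<tau> p = A" "inv_at \<tau> (Suc p) = B + (if \<tau> p > \<tau> (Suc p) then 1 else 0)"
    "inv_at ?v p = B" "inv_at ?v (Suc p) = A + (if \<tau> (Suc p) > \<tau> p then 1 else 0)"
    unfolding inv_at_def card_split v prefix A_def B_def by (rule refl)+
  have le: "A \<le> p - 1" "B \<le> p - 1"
    unfolding A_def B_def by (rule order_trans[OF card_mono[of "{1..<p}"]]; auto)+
  have mono: "\<tau> p < \<tau> (Suc p) \<Longrightarrow> B \<le> A" "\<tau> p > \<tau> (Suc p) \<Longrightarrow> A \<le> B"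
    unfolding A_def B_def by (intro card_mono; auto)+
  have B_max: "B = p - 1 \<longleftrightarrow> (\<forall>k\<in>{1..<p}. \<tau> k > \<tau> (Suc p))"
  proof
    assume "B = p - 1"
    then have "{i \<in> {1..<p}. \<tau> i > \<tau> (Suc p)} = {1..<p}"
      unfolding B_def by (intro card_subset_eq) auto
    then show "\<forall>k\<in>{1..<p}. \<tau> k > \<tau> (Suc p)" by blast
  next
    assume "\<forall>k\<in>{1..<p}. \<tau> k > \<tau> (Suc p)"
    then have "{i \<in> {1..<p}. \<tau> i > \<tau> (Suc p)} = {1..<p}" by blast
    then show "B = p - 1" unfolding B_def by simp
  qed
  have sum_split: "alt_len n f = min (inv_at f p) (p - 2) + min (inv_at f (Suc p)) (Suc p - 2) +
    (\<Sum>j\<in>{1..Suc n} - {p, Suc p}. min (inv_at f j) (j - 2))" for f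
  proof -
    have "alt_len n f = (\<Sum>j\<in>{1..Suc n} - {p, Suc p}. min (inv_at f j) (j - 2)) +
      (\<Sum>j\<in>{p, Suc p}. min (inv_at f j) (j - 2))"
      unfolding alt_len_def using p by (intro sum.subset_diff) auto
    then show ?thesis by simp
  qed
  have "(\<Sum>j\<in>{1..Suc n} - {p, Suc p}. min (inv_at ?v j) (j - 2)) =
    (\<Sum>j\<in>{1..Suc n} - {p, Suc p}. min (inv_at \<tau> j) (j - 2))"
    using p by (intro sum.cong) (auto simp: inv_at_s_gen_other)
  then have "alt_len n ?v \<le> alt_len n \<tau> \<longleftrightarrow>
    min B (p - 2) + min (A + (if \<tau> (Suc p) > \<tau> p then 1 else 0)) (Suc p - 2) \<le>
    min A (p - 2) + min (B + (if \<tau> p > \<tau> (Suc p) then 1 else 0)) (Suc p - 2)"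
    unfolding sum_split inv by linarith
  then show ?thesis
    unfolding B_max[symmetric] using le mono p \<tau>
    by (cases "\<tau> p < \<tau> (Suc p)") (auto simp: min_def split: if_splits)
qed

text \<open>Since \<open>v \<circ> a_gen i\<close> is
  \<open>(v \<circ> s_gen 1) \<circ> s_gen (Suc i)\<close>, and \<open>v\<close> has the same
  \<open>alt_len\<close> as \<open>v \<circ> s_gen 1\<close>, the comparison is one adjacent swap
  applied to \<open>v \<circ> s_gen 1\<close>. The invariance of \<open>alt_des\<close> then returns
  to \<open>v\<close>.\<close>

lemma Des_A_eq:
  assumes n: "n \<ge> 1" and v: "v \<in> Alt (n + 1)"
  shows "Des_A n v = {i \<in> {1..n - 1}. alt_des v i}"
proof -
  have "len_A n (v \<circ> a_gen i) \<le> len_A n v \<longleftrightarrow> alt_des v i" if i: "1 \<le> i" "i \<le> n - 1" for i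
  proof -
    have perm: "v permutes {1..n + 1}" "evenperm v" using v by (auto simp: Alt_def)
    have a: "a_gen i permutes {1..n + 1}"
      unfolding a_gen_def using i n by (intro permutes_compose s_gen_permutes) auto
    have "v \<circ> a_gen i \<in> Alt (n + 1)"
      unfolding Alt_def mem_Collect_eq
      using permutes_compose[OF a perm(1)] evenperm_comp[OF permutes_imp_permutation[OF perm(1)]
          permutes_imp_permutation[OF a]] perm(2) even_a_gen[of i] by simp
    then have 1: "len_A n (v \<circ> a_gen i) = alt_len n ((v \<circ> s_gen 1) \<circ> s_gen (Suc i))"
      using len_A_eq_alt_len[OF n, of "v \<circ> a_gen i"] by (simp only: a_gen_def comp_assoc Suc_eq_plus1)
    have 2: "len_A n v = alt_len n (v \<circ> s_gen 1)"
      using len_A_eq_alt_len[OF n v] alt_len_s_gen_1 by simp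
    have "inj (v \<circ> s_gen 1)"
      using permutes_inj[OF perm(1)] by (intro inj_compose) (simp_all add: s_gen_def)
    then have "(v \<circ> s_gen 1) (Suc i) \<noteq> (v \<circ> s_gen 1) (Suc (Suc i))"
      by (metis injD n_not_Suc_n)
    then have "len_A n (v \<circ> a_gen i) \<le> len_A n v \<longleftrightarrow> alt_des (v \<circ> s_gen 1) i"
      unfolding 1 2 alt_des_def using i
      by (subst alt_len_s_gen_le_iff) (auto simp: atLeastLessThanSuc_atLeastAtMost)
    then show ?thesis using alt_des_s_gen_1[OF i(1)] by simp
  qed
  then show ?thesis by (auto simp: Des_A_def)
qed

lemma Des_A_Suc:
  assumes n: "n \<ge> 1" and u: "u \<in> Alt (n + 1)" and p: "p \<in> {1..Suc (Suc n)}"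
  shows "Des_A (Suc n) (u \<circ> word_perm (a_word n p)) = insert_des n (max 1 (p - 1)) (Des_A n u)"
proof -
  obtain w where w: "w \<in> Sym (Suc n)" "w = u \<or> w = u \<circ> s_gen 1"
    "u \<circ> word_perm (a_word n p) = w \<circ> s_down (Suc n) p"
    using word_perm_insert_max[OF n u p] .
  have "u \<circ> word_perm (a_word n p) \<in> Alt (Suc n + 1)"
  proof -
    have "(u, a_word n p) \<in> Alt (n + 1) \<times> R_A n" using u p R_A_eq_image[OF n] by auto
    from bij_betw_apply[OF bij_betw_Alt_Suc[OF n] this] show ?thesis by (simp only: prod.case)
  qed
  then have "Des_A (Suc n) (u \<circ> word_perm (a_word n p)) =
    {i \<in> {1..Suc n - 1}. alt_des (w \<circ> s_down (Suc n) p) i}"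
    using Des_A_eq[of "Suc n"] by (simp only: w(3))
  also have "\<dots> = insert_des n (max 1 (p - 1)) {i \<in> {1..n - 1}. alt_des w i}"
    by (rule alt_des_set_insert_max[OF w(1) p n])
  also have "{i \<in> {1..n - 1}. alt_des w i} = {i \<in> {1..n - 1}. alt_des u i}"
    using w(2) alt_des_s_gen_1 by auto
  also have "\<dots> = Des_A n u"
    by (rule Des_A_eq[OF n u, symmetric])
  finally show ?thesis .
qed

lemma Des_A_subset: "Des_A n u \<subseteq> {1..<n}"
  by (auto simp: Des_A_def)

lemma rmaj_A_Suc:
  assumes "n \<ge> 1" "u \<in> Alt (n + 1)" "p \<in> {1..Suc (Suc n)}"
  shows "rmaj_A (Suc n) (u \<circ> word_perm (a_word n p)) =
    rmaj_A n u + insert_inc n (Des_A n u) (max 1 (p - 1))"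
  unfolding rmaj_A_def Des_A_Suc[OF assms] using assms Des_A_subset
  by (intro sum_insert_des) auto

section \<open>The alternating group\<close>

lemma finite_Alt: "finite (Alt n)"
  using finite_Sym Alt_subset_Sym by (metis finite_subset subsetI)

text \<open>Positions 1 and 2 both raise \<open>del_A\<close> by one and the statistic by
  \<open>n\<close>, which doubles the front term; the others match the symmetric case.\<close>

lemma gf_step_A:
  assumes n: "n \<ge> 1" and u: "u \<in> Alt (n + 1)"
    and s: "\<And>p. p \<in> {1..Suc (Suc n)} \<Longrightarrow>
      s (Suc n) (u \<circ> word_perm (a_word n p)) = s n u + inc (max 1 (p - 1))"
    and inc: "inc 1 = n" "bij_betw inc {2..Suc n} {..<n}"
  shows "(\<Sum>r\<in>R_A n. monom (monom (1::int) (s (Suc n) (u \<circ> word_perm r)))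
      (del_A (Suc n) (u \<circ> word_perm r))) =
    monom (monom 1 (s n u)) (del_A n u) * (2 * monom (monom 1 n) 1 + (\<Sum>j<n. monom (monom 1 j) 0))"
proof -
  let ?X = "\<lambda>p. monom (monom (1::int) (s (Suc n) (u \<circ> word_perm (a_word n p))))
    (del_A (Suc n) (u \<circ> word_perm (a_word n p)))"
  let ?M = "monom (monom (1::int) (s n u)) (del_A n u)"
  have "(\<Sum>r\<in>R_A n. monom (monom (1::int) (s (Suc n) (u \<circ> word_perm r)))
      (del_A (Suc n) (u \<circ> word_perm r))) = (\<Sum>p\<in>{1..Suc (Suc n)}. ?X p)"
    unfolding R_A_eq_image[OF n] using sum.reindex[OF inj_on_a_word[OF n]]
    by (simp add: comp_def del: sum.cl_ivl_Suc)
  also have "{1..Suc (Suc n)} = insert 1 (insert 2 {Suc 2..Suc (Suc n)})" by auto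
  also have "(\<Sum>p\<in>insert 1 (insert 2 {Suc 2..Suc (Suc n)}). ?X p) =
    ?X 1 + (?X 2 + (\<Sum>p\<in>{Suc 2..Suc (Suc n)}. ?X p))"
    by (subst sum.insert; (subst sum.insert)?) auto
  also have "?X 1 = ?M * monom (monom 1 n) 1"
    using s[of 1] del_A_Suc[OF n u, of 1] inc(1) by (simp add: mult_monom)
  also have "?X 2 = ?M * monom (monom 1 n) 1"
    using s[of 2] del_A_Suc[OF n u, of 2] inc(1) by (simp add: mult_monom)
  \<comment> \<open>Reindexing by \<open>m = p - 1\<close> makes the increment
    \<open>inc m\<close>.\<close>
  also have "(\<Sum>p\<in>{Suc 2..Suc (Suc n)}. ?X p) = (\<Sum>m\<in>{2..Suc n}. ?X (Suc m))"
    by (rule sum.shift_bounds_cl_Suc_ivl)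
  also have "\<dots> = (\<Sum>m\<in>{2..Suc n}. monom (monom 1 (s n u + inc m)) (del_A n u))"
  proof (rule sum.cong)
    fix m assume "m \<in> {2..Suc n}"
    then show "?X (Suc m) = monom (monom 1 (s n u + inc m)) (del_A n u)"
      using s[of "Suc m"] del_A_Suc[OF n u, of "Suc m"] by (simp add: max_def)
  qed simp
  also have "\<dots> = ?M * (\<Sum>j<n. monom (monom 1 j) 0)"
    by (rule sum_over_insertions[OF inc(2)])
  finally show ?thesis
    by (simp only: distrib_left mult_2 add.assoc)
qed

lemma equidistribution_A:
  assumes "n \<ge> 1"
  shows "(\<Sum>\<sigma>\<in>B_A n k. monom (1::int) (len_A n \<sigma>)) = (\<Sum>\<sigma>\<in>B_A n k. monom 1 (rmaj_A n \<sigma>))"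
  unfolding B_A_def
proof (rule equidistribution_of_chain[where G = "\<lambda>n. Alt (n + 1)" and R = R_A and \<phi> = word_perm,
      OF bij_betw_Alt_Suc finite_Alt _ _ _ assms])
  show "len_A 1 v = rmaj_A 1 v" for v
    by (simp add: len_A_def rmaj_A_def Des_A_def)
  show "(\<Sum>r\<in>R_A n. monom (monom (1::int) (len_A (Suc n) (u \<circ> word_perm r)))
        (del_A (Suc n) (u \<circ> word_perm r))) =
      monom (monom 1 (len_A n u)) (del_A n u) * (2 * monom (monom 1 n) 1 + (\<Sum>j<n. monom (monom 1 j) 0))"
    if "n \<ge> 1" "u \<in> Alt (n + 1)" for n u
  proof (rule gf_step_A[where s = len_A and inc = "\<lambda>m. Suc n - m", OF that _ _ bij_betw_reverse])
    fix p assume p: "p \<in> {1..Suc (Suc n)}"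
    \<comment> \<open>This rewrites the growth of \<open>len_A\<close> as the reversal
      \<open>\<lambda>m. Suc n - m\<close> evaluated at \<open>max 1 (p - 1)\<close>.\<close>
    have "Suc (Suc n) - max p 2 = Suc n - max 1 (p - 1)" using p by (auto simp: max_def)
    then show "len_A (Suc n) (u \<circ> word_perm (a_word n p)) = len_A n u + (Suc n - max 1 (p - 1))"
      using len_A_Suc[OF that p] by simp
  qed simp
  show "(\<Sum>r\<in>R_A n. monom (monom (1::int) (rmaj_A (Suc n) (u \<circ> word_perm r)))
        (del_A (Suc n) (u \<circ> word_perm r))) =
      monom (monom 1 (rmaj_A n u)) (del_A n u) * (2 * monom (monom 1 n) 1 + (\<Sum>j<n. monom (monom 1 j) 0))"
    if "n \<ge> 1" "u \<in> Alt (n + 1)" for n u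
    by (rule gf_step_A[where s = rmaj_A and inc = "insert_inc n (Des_A n u)", OF that rmaj_A_Suc[OF that]
        insert_inc_1[OF Des_A_subset] bij_betw_insert_inc[OF Des_A_subset]])
qed

theorem theorem6p2:
  fixes n k :: nat
  assumes "n \<ge> 1" and "k \<le> n - 1"
  shows "(\<Sum>\<sigma>\<in>B_S n k. monom (1::int) (len_S n \<sigma>)) = (\<Sum>\<sigma>\<in>B_S n k. monom 1 (rmaj_S n \<sigma>))
    \<and> (\<Sum>\<sigma>\<in>B_A n k. monom (1::int) (len_A n \<sigma>)) = (\<Sum>\<sigma>\<in>B_A n k. monom 1 (rmaj_A n \<sigma>))"
  using equidistribution_S[OF assms(1)] equidistribution_A[OF assms(1)] by simp

end
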